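(* Let $p$ be a prime. (1) Let $\lambda\in\Lambda_n^+$ and assume $n=1$ or $\lambda_1=1$. For a finite group $G$, the equality $\zeta_G(s)=\zeta_{G_\lambda}(s)$ implies $G\cong G_\lambda$. (2) Let $\lambda\in\Lambda_n^+$ with $n\ge2$. Assume $\lambda_1>\lambda_2$, and $\lambda_1\ge3$ if $p=2$. Then there exists a non-abelian group $\widetilde{G_\lambda}$ for which $\zeta_{\widetilde{G_\lambda}}(s)=\zeta_{G_\lambda}(s)$; for example, one may take the group $\widetilde{G_\lambda}$ with generators $a_1,\ldots,a_n$ and relations $$a_i^{p^{\lambda_i}}=1\ (1\le i\le n),\qquad a_na_1a_n^{-1}=a_1^{1+p^{\lambda_1-1}},\qquad a_ia_j=a_ja_i\ \text{ unless }\{i,j\}=\{1,n\}.$$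
   Context: All groups are finite. For a finite group $G$ and $m\ge 1$, let $a_m(G)$ be the number of subgroups of $G$ of order $m$; the zeta function of $G$ is $\zeta_G(s)=\sum_{m\ge1} a_m(G)\,m^{-s}$, $s\in\mathbb C$, and equality of zeta functions means equality as functions of $s$. For $n\ge1$, $\Lambda_n^+=\{\lambda\in\mathbb Z^n:\lambda_1\ge\lambda_2\ge\cdots\ge\lambda_n>0\}$, and for $\lambda\in\Lambda_n^+$, $G_\lambda=\mathbb Z/p^{\lambda_1}\mathbb Z\oplus\cdots\oplus\mathbb Z/p^{\lambda_n}\mathbb Z$. *)

theory Defs
  imports
    "HOL-Algebra.Product_Groups"
    "HOL-Analysis.Infinite_Sum"
    "HOL-Analysis.Complex_Transcendental"
begin

definition subgroup_count :: "('a, 'b) monoid_scheme \<Rightarrow> nat \<Rightarrow> nat" where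
  "subgroup_count G m = card {H. subgroup H G \<and> card H = m}"

text \<open>For a finite group only finitely many terms are non-zero.\<close>

definition group_zeta :: "('a, 'b) monoid_scheme \<Rightarrow> complex \<Rightarrow> complex" where
  "group_zeta G s =
    (\<Sum>\<^sub>\<infinity>m\<in>{1..}. of_nat (subgroup_count G m) * of_nat m powr (- s))"

definition Lambda_plus :: "nat \<Rightarrow> (nat \<Rightarrow> nat) set" where
  "Lambda_plus n =
    {lam \<in> {1..n} \<rightarrow>\<^sub>E {0<..}. \<forall>i\<in>{1..n}. \<forall>j\<in>{1..n}. i \<le> j \<longrightarrow> lam j \<le> lam i}"

definition abelian_p_group :: "nat \<Rightarrow> nat \<Rightarrow> (nat \<Rightarrow> nat) \<Rightarrow> (nat \<Rightarrow> int) monoid" where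
  "abelian_p_group p n lam = product_group {1..n} (\<lambda>i. integer_mod_group (p ^ lam i))"

text \<open>
  Words in the letters \<open>x\<close> and their formal inverses: the pair \<open>(x, True)\<close> stands for
  \<open>x\<close> and \<open>(x, False)\<close> for the inverse of \<open>x\<close>.
\<close>

type_synonym 'x word = "('x \<times> bool) list"

definition words :: "'x set \<Rightarrow> 'x word set" where
  "words X = lists (X \<times> UNIV)"

text \<open>
  The least congruence on the words over \<open>X\<close> that makes formally inverse letters inverse to
  each other and identifies \<open>u\<close> with \<open>v\<close> for every relation \<open>u = v\<close>, given as the
  pair \<open>(u, v) \<in> R\<close>.
\<close>

inductive_set word_cong :: "'x set \<Rightarrow> ('x word \<times> 'x word) set \<Rightarrow> ('x word \<times> 'x word) set"
  for X :: "'x set" and R :: "('x word \<times> 'x word) set" where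
  refl: "w \<in> words X \<Longrightarrow> (w, w) \<in> word_cong X R"
| sym: "(u, v) \<in> word_cong X R \<Longrightarrow> (v, u) \<in> word_cong X R"
| trans: "(u, v) \<in> word_cong X R \<Longrightarrow> (v, w) \<in> word_cong X R \<Longrightarrow> (u, w) \<in> word_cong X R"
| append: "(u, v) \<in> word_cong X R \<Longrightarrow> (u', v') \<in> word_cong X R \<Longrightarrow>
    (u @ u', v @ v') \<in> word_cong X R"
| cancel: "x \<in> X \<Longrightarrow> ([(x, b), (x, \<not> b)], []) \<in> word_cong X R"
| relation: "(u, v) \<in> R \<Longrightarrow> u \<in> words X \<Longrightarrow> v \<in> words X \<Longrightarrow> (u, v) \<in> word_cong X R"

definition presented_group :: "'x set \<Rightarrow> ('x word \<times> 'x word) set \<Rightarrow> 'x word set monoid" where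
  "presented_group X R =
    \<lparr>carrier = words X // word_cong X R,
     monoid.mult = (\<lambda>A B. \<Union>u\<in>A. \<Union>v\<in>B. word_cong X R `` {u @ v}),
     one = word_cong X R `` {[]}\<rparr>"

abbreviation letter :: "'x \<Rightarrow> 'x word" where
  "letter x \<equiv> [(x, True)]"

abbreviation inv_letter :: "'x \<Rightarrow> 'x word" where
  "inv_letter x \<equiv> [(x, False)]"

abbreviation letter_power :: "'x \<Rightarrow> nat \<Rightarrow> 'x word" where
  "letter_power x k \<equiv> replicate k (x, True)"

definition twisted_relations :: "nat \<Rightarrow> nat \<Rightarrow> (nat \<Rightarrow> nat) \<Rightarrow> (nat word \<times> nat word) set" where
  "twisted_relations p n lam =
     {(letter_power i (p ^ lam i), []) | i. i \<in> {1..n}} \<union>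
     {(letter n @ letter 1 @ inv_letter n, letter_power 1 (1 + p ^ (lam 1 - 1)))} \<union>
     {(letter i @ letter j, letter j @ letter i) | i j.
        i \<in> {1..n} \<and> j \<in> {1..n} \<and> {i, j} \<noteq> {1, n}}"

definition twisted_p_group :: "nat \<Rightarrow> nat \<Rightarrow> (nat \<Rightarrow> nat) \<Rightarrow> nat word set monoid" where
  "twisted_p_group p n lam = presented_group {1..n} (twisted_relations p n lam)"

end

theory Submission
  imports
    Defs
    "HOL-Algebra.Multiplicative_Group"
    "HOL-Computational_Algebra.Polynomial"
    "HOL-Number_Theory.Cong"
begin

text \<open>
  A Dirichlet polynomial determines its coefficients, so groups with equal zeta functions have the
  same order and the same number of subgroups of each order. In a group with at most one subgroup
  of each order \<open>p ^ k\<close>, too few elements have smaller order than the group, whence it is cyclic. If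
  \<open>\<lambda>\<^sub>1 = 1\<close>, the number of subgroups of order \<open>p\<close> forces exponent \<open>p\<close>, and the number of subgroups of
  order \<open>p\<^sup>2\<close>, each of which is abelian, forces any two elements to commute.

  For the second part, the twisted group is realised on the underlying set of \<open>G\<^sub>\<lambda>\<close> by
  \<open>x * y = x + y + x\<^sub>n y\<^sub>1 c\<close> with \<open>c = p ^ (\<lambda>\<^sub>1 - 1) e\<^sub>1\<close>. If some \<open>x\<close> in a subset closed under either
  operation has a unit as its first coordinate, its \<open>p ^ (\<lambda>\<^sub>1 - 1)\<close>-th power, taken in either
  structure, is a generator of \<open>\<langle>c\<rangle>\<close> (for \<open>p = 2\<close> this needs \<open>\<lambda>\<^sub>1 \<ge> 3\<close>); otherwise the two operations agree on the subset. Hence both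
  structures have literally the same subgroups.
\<close>

subsection \<open>Subgroup counts and zeta functions\<close>

text \<open>Relations bound the order of a presented group only from above; a concrete model is
  needed to see that nothing collapses. That is why the twisted group is modelled on residue
  vectors, which moreover turns the comparison of subgroups into an equality of families of sets.
  The element \<open>c\<close> is the commutator prescribed by the last generator acting on the
  first one. It has order \<open>p\<close>, so a correction matters only modulo \<open>p\<close>,
  and \<open>lam 1 > lam 2\<close> makes the exponent \<open>p ^ (lam 1 - 1)\<close> kill every
  coordinate but the first. Powers in the twisted group pick up the coefficient
  \<open>p ^ (lam 1 - 1) choose 2\<close>, which \<open>p\<close> divides unless
  \<open>p = 2\<close> and \<open>lam 1 = 2\<close>; this is the source of the exception. In a group
  of exponent \<open>p\<close>, the number of pairs (x, y) with x nontrivial and y outside <x>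
  depends only on \<open>p\<close> and the order of the group, while the number of those generating
  a subgroup of order \<open>p\<^sup>2\<close> is a fixed multiple of the number of such subgroups.
  In an elementary abelian group the two numbers agree, hence they agree in any group with the same
  zeta function.\<close>

lemma finite_subgroups: "finite (carrier G) \<Longrightarrow> finite {H. subgroup H G \<and> card H = m}"
  by (rule finite_subset[of _ "Pow (carrier G)"]) (auto dest: subgroup.subset)

lemma subgroup_count_pos_iff:
  assumes "finite (carrier G)"
  shows "subgroup_count G m > 0 \<longleftrightarrow> (\<exists>H. subgroup H G \<and> card H = m)"
  using finite_subgroups[OF assms, of m]
  unfolding subgroup_count_def by (auto simp: card_gt_0_iff)

lemma subgroup_count_eq_0:
  assumes "finite (carrier G)" "card (carrier G) < m"
  shows "subgroup_count G m = 0"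
proof -
  have "card H \<le> card (carrier G)" if "subgroup H G" for H
    using card_mono[OF assms(1) subgroup.subset[OF that]] .
  with assms(2) have "{H. subgroup H G \<and> card H = m} = {}"
    by (auto simp: not_le[symmetric])
  then show ?thesis
    by (simp only: subgroup_count_def card.empty)
qed

lemma group_zeta_finite_sum:
  assumes "finite (carrier G)" "card (carrier G) \<le> N"
  shows "group_zeta G s = (\<Sum>m=1..N. of_nat (subgroup_count G m) * of_nat m powr (- s))"
proof -
  have "group_zeta G s = (\<Sum>\<^sub>\<infinity>m\<in>{1..N}. of_nat (subgroup_count G m) * of_nat m powr (- s))"
    unfolding group_zeta_def
    by (rule infsum_cong_neutral) (use assms in \<open>auto simp: subgroup_count_eq_0\<close>)
  then show ?thesis
    by simp
qed

lemma group_zeta_cong: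
  assumes "\<And>m. subgroup_count G m = subgroup_count H m"
  shows "group_zeta G = group_zeta H"
  unfolding group_zeta_def assms ..

text \<open>Test the moments against the Lagrange basis.\<close>

lemma power_moments_zero_imp_zero:
  fixes c :: "nat \<Rightarrow> complex"
  assumes moments: "\<And>k. (\<Sum>m=1..N. c m * of_nat m ^ k) = 0" and m: "m \<in> {1..N}"
  shows "c m = 0"
proof -
  have poly: "(\<Sum>i=1..N. c i * poly q (of_nat i)) = 0" for q
  proof -
    have "(\<Sum>i=1..N. c i * poly q (of_nat i)) =
          (\<Sum>i=1..N. \<Sum>k\<le>degree q. coeff q k * (c i * of_nat i ^ k))"
      by (simp add: poly_altdef sum_distrib_left mult_ac)
    also have "\<dots> = (\<Sum>k\<le>degree q. coeff q k * (\<Sum>i=1..N. c i * of_nat i ^ k))"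
      by (subst sum.swap) (simp add: sum_distrib_left)
    finally show ?thesis
      unfolding moments by simp
  qed
  define q :: "complex poly" where "q = (\<Prod>j\<in>{1..N} - {m}. [:- of_nat j, 1:])"
  have "poly q (of_nat i) = 0" if "i \<in> {1..N} - {m}" for i
    using that by (auto simp: q_def poly_prod)
  then have "(\<Sum>i=1..N. c i * poly q (of_nat i)) = c m * poly q (of_nat m)"
    using m by (subst sum.remove[of _ m]) auto
  moreover have "poly q (of_nat m) \<noteq> 0"
    by (auto simp: q_def poly_prod)
  ultimately show ?thesis
    using poly by simp
qed

text \<open>At s = -k the m-th term becomes a_m m^k, so the values at the non-positive integers
  alone make all moments of the coefficient differences vanish. Cutting both sums at the larger of
  the two orders gives them a common range.\<close>

lemma group_zeta_eq_imp_subgroup_count_eq: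
  assumes fin: "finite (carrier G)" "finite (carrier H)"
    and zeta: "group_zeta G = group_zeta H" and "m \<ge> 1"
  shows "subgroup_count G m = subgroup_count H m"
proof (cases "m \<le> max (card (carrier G)) (card (carrier H))")
  case True
  define N where "N = max (card (carrier G)) (card (carrier H))"
  define c :: "nat \<Rightarrow> complex"
    where "c i = of_nat (subgroup_count G i) - of_nat (subgroup_count H i)" for i
  have "c m = 0"
  proof (rule power_moments_zero_imp_zero[where N = N])
    fix k
    have "of_nat i powr (- (- of_nat k)) = (of_nat i ^ k :: complex)" if "i \<in> {1..N}" for i
      using that by (simp add: powr_nat)
    moreover have "(\<Sum>i=1..N. c i * of_nat i powr (- (- of_nat k))) = 0"
      using fun_cong[OF zeta, of "- of_nat k"] fin
      by (simp add: group_zeta_finite_sum[where N = N] N_def c_def left_diff_distrib sum_subtractf)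
    ultimately show "(\<Sum>i=1..N. c i * of_nat i ^ k) = 0"
      by simp
  qed (use True \<open>m \<ge> 1\<close> in \<open>auto simp: N_def\<close>)
  then show ?thesis
    by (simp add: c_def)
next
  case False
  then show ?thesis
    using fin by (simp add: subgroup_count_eq_0)
qed

text \<open>Each group is a subgroup of itself, so the order of a group is the largest index with a
  nonzero coefficient.\<close>

lemma group_zeta_eq_imp_card_eq:
  assumes "group G" "group H" and fin: "finite (carrier G)" "finite (carrier H)"
    and zeta: "group_zeta G = group_zeta H"
  shows "card (carrier G) = card (carrier H)"
proof -
  interpret G: group G by fact
  interpret H: group H by fact
  have pos: "card (carrier G) \<ge> 1" "card (carrier H) \<ge> 1"
    using fin G.one_closed H.one_closed by (auto simp: Suc_le_eq card_gt_0_iff)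
  have count: "subgroup_count G m = subgroup_count H m" if "m \<ge> 1" for m
    using group_zeta_eq_imp_subgroup_count_eq[OF fin zeta that] .
  have "subgroup_count G (card (carrier G)) > 0" "subgroup_count H (card (carrier H)) > 0"
    unfolding subgroup_count_pos_iff[OF fin(1)] subgroup_count_pos_iff[OF fin(2)]
    using G.subgroup_self H.subgroup_self by blast+
  then have "subgroup_count H (card (carrier G)) > 0" "subgroup_count G (card (carrier H)) > 0"
    using count pos by auto
  then show ?thesis
    using subgroup_count_eq_0[OF fin(1)] subgroup_count_eq_0[OF fin(2)]
    by (metis linorder_neqE_nat less_irrefl)
qed

lemma subgroup_count_iso:
  assumes "group G" "group H" "G \<cong> H"
  shows "subgroup_count G m = subgroup_count H m"
proof -
  interpret G: group G by fact
  interpret H: group H by fact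
  obtain f where f: "f \<in> iso G H"
    using assms by (auto simp: is_iso_def)
  interpret f: group_hom G H f
    using f by unfold_locales (auto simp: iso_def)
  have bij: "bij_betw f (carrier G) (carrier H)"
    using f by (auto simp: iso_def)
  then have inj: "inj_on f (carrier G)" and surj: "f ` carrier G = carrier H"
    by (auto simp: bij_betw_def)
  have "bij_betw ((`) f) {K. subgroup K G \<and> card K = m} {K. subgroup K H \<and> card K = m}"
  proof (rule bij_betw_imageI)
    show "inj_on ((`) f) {K. subgroup K G \<and> card K = m}"
      by (rule inj_on_subset[OF inj_on_image_Pow[OF inj]]) (auto dest: subgroup.subset)
    show "(`) f ` {K. subgroup K G \<and> card K = m} = {K. subgroup K H \<and> card K = m}" (is "?L = ?R")
    proof
      show "?L \<subseteq> ?R"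
        using f.subgroup_img_is_subgroup card_image inj_on_subset[OF inj subgroup.subset] by blast
      show "?R \<subseteq> ?L"
      proof
        fix K assume K: "K \<in> ?R"
        then have KH: "K \<subseteq> carrier H" "subgroup K H" "card K = m"
          by (auto dest: subgroup.subset)
        define L where "L = {x \<in> carrier G. f x \<in> K}"
        have "subgroup L G"
        proof (rule G.subgroupI)
          have "\<one>\<^bsub>G\<^esub> \<in> L"
            using subgroup.one_closed[OF KH(2)] by (simp add: L_def)
          then show "L \<noteq> {}"
            by blast
        qed (auto simp: L_def subgroup.m_closed[OF KH(2)] subgroup.m_inv_closed[OF KH(2)])
        moreover have img: "f ` L = K"
        proof -
          have "f ` L = f ` carrier G \<inter> K"
            unfolding L_def by blast
          then show ?thesis
            using KH(1) surj by blast
        qed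
        moreover have "card L = m"
        proof -
          have "inj_on f L"
            using inj by (rule inj_on_subset) (auto simp: L_def)
          then show ?thesis
            using card_image[of f L] img KH(3) by simp
        qed
        ultimately show "K \<in> ?L"
          by (intro image_eqI[of _ _ L]) auto
      qed
    qed
  qed
  then show ?thesis
    unfolding subgroup_count_def by (rule bij_betw_same_card)
qed

subsection \<open>Ordered products of powers\<close>

text \<open>In a finite group the inverse of an element is one of its positive powers.\<close>

lemma (in group) finite_mult_closed_imp_subgroup:
  assumes fin: "finite (carrier G)" and H: "H \<subseteq> carrier G" "H \<noteq> {}"
    and closed: "\<And>x y. x \<in> H \<Longrightarrow> y \<in> H \<Longrightarrow> x \<otimes> y \<in> H"
  shows "subgroup H G"
proof (rule subgroupI)
  fix x assume x: "x \<in> H"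
  then have xG: "x \<in> carrier G"
    using H by blast
  have pow: "x [^] Suc k \<in> H" for k :: nat
    by (induction k) (use x xG closed in auto)
  \<comment> \<open>The inverse is taken as the power with exponent twice the order minus 1. With
    the order minus 1, the exponent would be 0 in the trivial group, and closure under products
    yields only positive powers.\<close>
  define k where "k = 2 * Coset.order G - 2"
  have "Coset.order G > 0"
    using fin order_gt_0_iff_finite by blast
  then have "Suc (Suc k) = Coset.order G * 2"
    by (simp add: k_def)
  moreover have "x [^] (Coset.order G * 2) = \<one>"
    using xG by (simp add: pow_order_eq_1 flip: nat_pow_pow)
  ultimately have "x [^] Suc k \<otimes> x = \<one>"
    by (metis nat_pow_Suc)
  then have "inv x = x [^] Suc k"
    using xG by (intro inv_equality) auto
  then show "inv x \<in> H"
    using pow by simp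
qed (use H closed in auto)

text \<open>Conjugation by \<open>g\<close> is an endomorphism sending \<open>b\<close> to
  \<open>c\<close>, hence powers of \<open>b\<close> to powers of \<open>c\<close>. The case
  \<open>c = b\<close> handles commuting elements, the general case the twisted relation.\<close>

lemma (in group) intertwine_int_pow:
  fixes k :: int
  assumes [simp]: "g \<in> carrier G" "b \<in> carrier G" "c \<in> carrier G" and eq: "g \<otimes> b = c \<otimes> g"
  shows "g \<otimes> b [^] k = c [^] k \<otimes> g"
proof -
  interpret conj: group_hom G G "\<lambda>x. g \<otimes> x \<otimes> inv g"
    by unfold_locales (auto simp: hom_def m_assoc inv_solve_left)
  have "c = g \<otimes> b \<otimes> inv g"
    using eq by (simp add: inv_solve_right)
  then have "c [^] k = g \<otimes> b [^] k \<otimes> inv g"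
    using conj.hom_int_pow[of b k] by simp
  then show ?thesis
    by (simp add: m_assoc)
qed

lemma (in group) int_pow_mod_exponent:
  fixes m k :: int
  assumes x: "x \<in> carrier G" and "x [^] m = \<one>"
  shows "x [^] (k mod m) = x [^] k"
proof -
  have "x [^] k = x [^] (m * (k div m) + k mod m)"
    by simp
  also have "\<dots> = (x [^] m) [^] (k div m) \<otimes> x [^] (k mod m)"
    using x by (simp only: int_pow_mult int_pow_pow)
  finally show ?thesis
    using assms by simp
qed

text \<open>The factors stand in a fixed order because the group need not be commutative. These
  products serve as normal forms in the presented group and as coordinates in abelian
  groups.\<close>

primrec ordered_power_prod :: "('g, 'm) monoid_scheme \<Rightarrow> (nat \<Rightarrow> 'g) \<Rightarrow> (nat \<Rightarrow> int) \<Rightarrow> nat \<Rightarrow> 'g"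
where
  "ordered_power_prod G a x 0 = \<one>\<^bsub>G\<^esub>"
| "ordered_power_prod G a x (Suc k) = ordered_power_prod G a x k \<otimes>\<^bsub>G\<^esub> a (Suc k) [^]\<^bsub>G\<^esub> x (Suc k)"

lemma (in group) ordered_power_prod_closed [simp]:
  "a \<in> {1..k} \<rightarrow> carrier G \<Longrightarrow> ordered_power_prod G a x k \<in> carrier G"
  by (induction k) (auto simp: Pi_iff)

lemma ordered_power_prod_cong:
  assumes "\<And>i. i \<in> {1..k} \<Longrightarrow> a i = b i" "\<And>i. i \<in> {1..k} \<Longrightarrow> x i = y i"
  shows "ordered_power_prod G a x k = ordered_power_prod G b y k"
  using assms by (induction k) auto

lemma (in group) ordered_power_prod_zero:
  assumes "\<And>i. i \<in> {1..k} \<Longrightarrow> a i \<in> carrier G"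
  shows "ordered_power_prod G a (\<lambda>_. 0) k = \<one>"
  using assms by (induction k) auto

lemma (in group) ordered_power_prod_mod:
  assumes "\<And>i. i \<in> {1..k} \<Longrightarrow> a i \<in> carrier G" "\<And>i. i \<in> {1..k} \<Longrightarrow> a i [^] m i = \<one>"
  shows "ordered_power_prod G a (\<lambda>i\<in>{1..k}. x i mod m i) k = ordered_power_prod G a x k"
proof -
  have "ordered_power_prod G a (\<lambda>i. x i mod m i) k = ordered_power_prod G a x k"
    using assms by (induction k) (auto simp: int_pow_mod_exponent)
  then show ?thesis
    by (subst ordered_power_prod_cong[of k a a _ "\<lambda>i. x i mod m i"]) auto
qed

lemma (in group) commute_ordered_power_prod:
  assumes "g \<in> carrier G" "\<And>i. i \<in> {1..k} \<Longrightarrow> a i \<in> carrier G"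
    "\<And>i. i \<in> {1..k} \<Longrightarrow> g \<otimes> a i = a i \<otimes> g"
  shows "g \<otimes> ordered_power_prod G a x k = ordered_power_prod G a x k \<otimes> g"
  using assms
proof (induction k)
  case (Suc k)
  have [simp]: "a (Suc k) \<in> carrier G" "g \<in> carrier G"
    using Suc.prems by auto
  have [simp]: "ordered_power_prod G a x k \<in> carrier G"
    using Suc.prems by (intro ordered_power_prod_closed) auto
  have "g \<otimes> ordered_power_prod G a x (Suc k) = (g \<otimes> ordered_power_prod G a x k) \<otimes> a (Suc k) [^] x (Suc k)"
    by (simp add: m_assoc)
  also have "\<dots> = ordered_power_prod G a x k \<otimes> (g \<otimes> a (Suc k) [^] x (Suc k))"
    using Suc by (simp add: m_assoc)
  also have "g \<otimes> a (Suc k) [^] x (Suc k) = a (Suc k) [^] x (Suc k) \<otimes> g"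
    using Suc.prems by (intro intertwine_int_pow) auto
  finally show ?case
    by (simp add: m_assoc)
qed auto

lemma (in group_hom) hom_ordered_power_prod:
  assumes "\<And>i. i \<in> {1..k} \<Longrightarrow> a i \<in> carrier G"
  shows "h (ordered_power_prod G a x k) = ordered_power_prod H (\<lambda>i. h (a i)) x k"
  using assms
proof (induction k)
  case (Suc k)
  then have "a \<in> {1..k} \<rightarrow> carrier G" "a (Suc k) \<in> carrier G"
    by auto
  then show ?case
    using Suc by (simp add: hom_int_pow)
qed auto

text \<open>Exponents matter only modulo \<open>m i\<close>, so the finite box of residues already
  yields every product. This is the upper bound for the presented group, and also what leaves room
  for a further independent generator in an elementary abelian group.\<close>

lemma (in group) card_ordered_power_prods_le:
  assumes a: "\<And>i. i \<in> {1..n} \<Longrightarrow> a i \<in> carrier G"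
    and m: "\<And>i. i \<in> {1..n} \<Longrightarrow> a i [^] int (m i) = \<one>" "\<And>i. i \<in> {1..n} \<Longrightarrow> m i > 0"
  shows "finite (range (\<lambda>x. ordered_power_prod G a x n)) \<and>
         card (range (\<lambda>x. ordered_power_prod G a x n)) \<le> (\<Prod>i=1..n. m i)"
proof -
  let ?B = "\<Pi>\<^sub>E i\<in>{1..n}. {0..<int (m i)}"
  have "range (\<lambda>x. ordered_power_prod G a x n) \<subseteq> (\<lambda>x. ordered_power_prod G a x n) ` ?B"
  proof clarify
    fix x
    show "ordered_power_prod G a x n \<in> (\<lambda>x. ordered_power_prod G a x n) ` ?B"
      by (rule image_eqI[of _ _ "\<lambda>i\<in>{1..n}. x i mod int (m i)"])
        (use ordered_power_prod_mod[of n a "\<lambda>i. int (m i)" x] a m in auto)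
  qed
  moreover have "finite ?B" "card ?B = (\<Prod>i=1..n. m i)"
    by (auto intro: finite_PiE simp: card_PiE)
  ultimately show ?thesis
    using card_mono[OF finite_imageI] card_image_le[of ?B] finite_subset[OF _ finite_imageI]
    by (smt (verit, best) order_trans)
qed

text \<open>
  Moving a generator from the left into an ordered product of powers only changes the exponents:
  \<open>a n\<close> passes \<open>a 1\<close> at the price of raising it to the power \<open>r\<close>.
\<close>

lemma (in group) generator_mult_ordered_power_prod:
  assumes n: "n \<ge> 2" and a: "\<And>i. i \<in> {1..n} \<Longrightarrow> a i \<in> carrier G"
    and comm: "\<And>i j. i \<in> {1..n} \<Longrightarrow> j \<in> {1..n} \<Longrightarrow> {i, j} \<noteq> {1, n} \<Longrightarrow> a i \<otimes> a j = a j \<otimes> a i"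
    and twist: "a n \<otimes> a 1 = a 1 [^] (r::int) \<otimes> a n"
    and i: "i \<in> {1..n}"
  shows "a i \<otimes> ordered_power_prod G a x n \<in> range (\<lambda>y. ordered_power_prod G a y n)"
proof (cases "i = n")
  case False
  define y where "y = x(i := x i + 1)"
  have [simp]: "y i = x i + 1" and y: "j \<noteq> i \<Longrightarrow> y j = x j" for j
    by (auto simp: y_def)
  have "a i \<otimes> ordered_power_prod G a x k = ordered_power_prod G a y k"
    if "i \<le> k" "k \<le> n" for k
    using that
  proof (induction k rule: dec_induct)
    case base
    then obtain l where l: "i = Suc l"
      using i by (cases i) auto
    have [simp]: "a i \<in> carrier G"
      using a i by auto
    have [simp]: "ordered_power_prod G a x l \<in> carrier G"
      using a i l by (intro ordered_power_prod_closed) auto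
    have split: "ordered_power_prod G a y i = ordered_power_prod G a y l \<otimes> a i [^] y i" for y
      by (simp add: l)
    have "a i \<otimes> ordered_power_prod G a x i = a i \<otimes> ordered_power_prod G a x l \<otimes> a i [^] x i"
      by (simp add: split m_assoc)
    \<comment> \<open>The factors to be passed have an index j with j < i < n, so {i, j} is never
      the exceptional pair.\<close>
    also have "a i \<otimes> ordered_power_prod G a x l = ordered_power_prod G a x l \<otimes> a i"
      using i False l by (intro commute_ordered_power_prod a comm) (auto simp: doubleton_eq_iff)
    also have "\<dots> \<otimes> a i [^] x i = ordered_power_prod G a x l \<otimes> a i [^] (x i + 1)"
      by (simp add: m_assoc add.commute[of "x i"] flip: int_pow_mult)
        (simp add: int_pow_mult)
    also have "ordered_power_prod G a x l = ordered_power_prod G a y l"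
      by (rule ordered_power_prod_cong) (auto simp: l y)
    finally show ?case
      by (simp add: split)
  next
    case (step k)
    then have "a i \<in> carrier G" "a (Suc k) \<in> carrier G" "ordered_power_prod G a x k \<in> carrier G"
      using a i by (auto intro!: ordered_power_prod_closed)
    then show ?case
      using step by (simp add: y flip: m_assoc)
  qed
  then show ?thesis
    using i by auto
next
  case True
  have [simp]: "a n \<in> carrier G" "a 1 \<in> carrier G" "a (Suc 0) \<in> carrier G"
    using a n by auto
  define y where "y = x(1 := r * x 1)"
  have [simp]: "y (Suc 0) = r * x (Suc 0)"
    by (simp add: y_def)
  have y: "y j = x j" if "j \<noteq> 1" for j
    using that by (simp add: y_def)
  have pass: "a n \<otimes> ordered_power_prod G a x k = ordered_power_prod G a y k \<otimes> a n"
    if "1 \<le> k" "k < n" for k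
    using that
  proof (induction k rule: dec_induct)
    case base
    show ?case
      using intertwine_int_pow[OF _ _ _ twist, of "x 1"] by (simp add: int_pow_pow)
  next
    case (step k)
    have [simp]: "a (Suc k) \<in> carrier G" "ordered_power_prod G a y k \<in> carrier G" for y
      using a step by (auto intro!: ordered_power_prod_closed)
    have "a n \<otimes> ordered_power_prod G a x (Suc k) =
          ordered_power_prod G a y k \<otimes> (a n \<otimes> a (Suc k) [^] x (Suc k))"
      using step by (simp add: m_assoc[symmetric])
    also have "a n \<otimes> a (Suc k) [^] x (Suc k) = a (Suc k) [^] x (Suc k) \<otimes> a n"
      using step comm[of n "Suc k"] by (intro intertwine_int_pow) (auto simp: doubleton_eq_iff)
    finally show ?case
      using step by (simp add: m_assoc y)
  qed
  obtain l where l: "n = Suc l" "l \<ge> 1"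
    using n by (cases n) auto
  have [simp]: "ordered_power_prod G a y l \<in> carrier G" for y
    using a l by (intro ordered_power_prod_closed) auto
  have split: "ordered_power_prod G a y n = ordered_power_prod G a y l \<otimes> a n [^] y n" for y
    by (simp add: l)
  have "a n \<otimes> ordered_power_prod G a x n = a n \<otimes> ordered_power_prod G a x l \<otimes> a n [^] x n"
    by (simp add: split m_assoc)
  also have "\<dots> = ordered_power_prod G a y l \<otimes> a n [^] (1 + x n)"
  proof -
    have "a n \<otimes> ordered_power_prod G a x l = ordered_power_prod G a y l \<otimes> a n"
      using l by (intro pass) auto
    then show ?thesis
      by (simp only:) (simp add: m_assoc int_pow_mult)
  qed
  also have "\<dots> = ordered_power_prod G a (y(n := 1 + x n)) n"
    using l ordered_power_prod_cong[of l a a "y(n := 1 + x n)" y G]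
    by (simp only: split fun_upd_same) auto
  finally show ?thesis
    using True by auto
qed

subsection \<open>Presented groups\<close>

lemma word_cong_subset: "word_cong X R \<subseteq> words X \<times> words X"
proof clarify
  fix u v assume "(u, v) \<in> word_cong X R"
  then show "u \<in> words X \<and> v \<in> words X"
    by induction (auto simp: words_def)
qed

lemma equiv_word_cong: "equiv (words X) (word_cong X R)"
  using word_cong_subset
  by (intro equivI refl_onI symI transI) (auto intro: word_cong.intros)

abbreviation word_class :: "'x set \<Rightarrow> ('x word \<times> 'x word) set \<Rightarrow> 'x word \<Rightarrow> 'x word set" where
  "word_class X R w \<equiv> word_cong X R `` {w}"

lemma word_class_eq_iff:
  "u \<in> words X \<Longrightarrow> v \<in> words X \<Longrightarrow> word_class X R u = word_class X R v \<longleftrightarrow> (u, v) \<in> word_cong X R"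
  by (rule eq_equiv_class_iff[OF equiv_word_cong])

lemma carrier_presented_group: "carrier (presented_group X R) = word_class X R ` words X"
  by (auto simp: presented_group_def quotient_def)

lemma one_presented_group: "\<one>\<^bsub>presented_group X R\<^esub> = word_class X R []"
  by (simp add: presented_group_def)

lemma append_in_words [simp]: "u @ v \<in> words X \<longleftrightarrow> u \<in> words X \<and> v \<in> words X"
  by (auto simp: words_def)

lemma Cons_in_words [simp]: "l # u \<in> words X \<longleftrightarrow> fst l \<in> X \<and> u \<in> words X"
  by (cases l) (auto simp: words_def)

lemma Nil_in_words [simp]: "[] \<in> words X"
  by (simp add: words_def)

text \<open>The product is defined as a union over all representatives; by compatibility with
  concatenation all members of this union are the same class.\<close>

lemma mult_presented_group:
  assumes "u \<in> words X" "v \<in> words X"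
  shows "word_class X R u \<otimes>\<^bsub>presented_group X R\<^esub> word_class X R v = word_class X R (u @ v)"
proof -
  have eq: "word_class X R (u' @ v') = word_class X R (u @ v)"
    if "u' \<in> word_class X R u" "v' \<in> word_class X R v" for u' v'
    using that word_cong_subset[of X R] assms
    by (subst word_class_eq_iff) (auto intro!: word_cong.append intro: word_cong.sym)
  have "word_class X R u \<otimes>\<^bsub>presented_group X R\<^esub> word_class X R v =
      (\<Union>u'\<in>word_class X R u. \<Union>v'\<in>word_class X R v. word_class X R (u @ v))"
    unfolding presented_group_def monoid.simps by (rule SUP_cong[OF HOL.refl], rule SUP_cong[OF HOL.refl], rule eq)
  moreover have "u \<in> word_class X R u" "v \<in> word_class X R v"
    using assms by (auto intro: word_cong.refl)
  then have "word_class X R u \<noteq> {}" "word_class X R v \<noteq> {}"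
    by blast+
  ultimately show ?thesis
    by (simp only: UN_constant if_False)
qed

text \<open>The formal inverse reverses the word and flips its signs, so the innermost two letters
  cancel and induction removes the rest.\<close>

lemma words_cancel_left:
  assumes "u \<in> words X"
  shows "(rev (map (\<lambda>(x, b). (x, \<not> b)) u) @ u, []) \<in> word_cong X R"
  using assms
proof (induction u)
  case Nil
  show ?case
    by (simp add: word_cong.refl)
next
  case (Cons l u)
  obtain x b where l: "l = (x, b)"
    by (cases l)
  let ?v = "rev (map (\<lambda>(x, b). (x, \<not> b)) u)"
  have v: "?v \<in> words X"
    using Cons.prems by (auto simp: words_def)
  have "([(x, \<not> b), (x, b)], []) \<in> word_cong X R"
    using word_cong.cancel[of x X "\<not> b" R] Cons.prems l by simp
  then have "(?v @ [(x, \<not> b), (x, b)] @ u, ?v @ [] @ u) \<in> word_cong X R"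
    using v Cons.prems by (intro word_cong.append) (auto intro: word_cong.refl)
  then show ?case
    using Cons by (auto simp: l intro: word_cong.trans)
qed

lemma group_presented_group: "group (presented_group X R)"
proof (rule groupI)
  fix A assume "A \<in> carrier (presented_group X R)"
  then obtain u where u: "u \<in> words X" "A = word_class X R u"
    by (auto simp: carrier_presented_group)
  let ?v = "rev (map (\<lambda>(x, b). (x, \<not> b)) u)"
  have "?v \<in> words X"
    using u(1) by (auto simp: words_def)
  then show "\<exists>B\<in>carrier (presented_group X R). B \<otimes>\<^bsub>presented_group X R\<^esub> A = \<one>\<^bsub>presented_group X R\<^esub>"
    using u words_cancel_left[OF u(1), of R]
    by (intro bexI[of _ "word_class X R ?v"])
      (auto simp: mult_presented_group one_presented_group word_class_eq_iff carrier_presented_group)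
qed (auto simp: carrier_presented_group mult_presented_group one_presented_group)

section \<open>Evaluation of words and the universal property of a presentation\<close>

fun letter_value :: "('g, 'm) monoid_scheme \<Rightarrow> ('x \<Rightarrow> 'g) \<Rightarrow> 'x \<times> bool \<Rightarrow> 'g" where
  "letter_value G g (x, b) = (if b then g x else inv\<^bsub>G\<^esub> g x)"

primrec word_value :: "('g, 'm) monoid_scheme \<Rightarrow> ('x \<Rightarrow> 'g) \<Rightarrow> 'x word \<Rightarrow> 'g" where
  "word_value G g [] = \<one>\<^bsub>G\<^esub>"
| "word_value G g (l # w) = letter_value G g l \<otimes>\<^bsub>G\<^esub> word_value G g w"

lemma (in group) letter_value_closed [simp]:
  "g \<in> X \<rightarrow> carrier G \<Longrightarrow> fst l \<in> X \<Longrightarrow> letter_value G g l \<in> carrier G"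
  by (cases l) auto

lemma (in group) word_value_closed [simp]:
  "g \<in> X \<rightarrow> carrier G \<Longrightarrow> w \<in> words X \<Longrightarrow> word_value G g w \<in> carrier G"
  by (induction w) auto

lemma (in group) word_value_append:
  "g \<in> X \<rightarrow> carrier G \<Longrightarrow> u \<in> words X \<Longrightarrow> v \<in> words X \<Longrightarrow>
    word_value G g (u @ v) = word_value G g u \<otimes> word_value G g v"
  by (induction u) (auto simp: m_assoc)

lemma (in group) word_value_letter_power:
  "g x \<in> carrier G \<Longrightarrow> word_value G g (letter_power x k) = g x [^] k"
  using nat_pow_Suc2[of "g x"] by (induction k) simp_all

lemma (in group) word_value_word_cong:
  assumes g: "g \<in> X \<rightarrow> carrier G"
    and R: "\<And>u v. (u, v) \<in> R \<Longrightarrow> u \<in> words X \<Longrightarrow> v \<in> words X \<Longrightarrow> word_value G g u = word_value G g v"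
    and uv: "(u, v) \<in> word_cong X R"
  shows "word_value G g u = word_value G g v"
  using uv
proof induction
  case (append u v u' v')
  then have "u \<in> words X" "v \<in> words X" "u' \<in> words X" "v' \<in> words X"
    using word_cong_subset[of X R] by auto
  then show ?case
    using append.IH by (simp add: word_value_append[OF g])
next
  case (cancel x b)
  then have "g x \<in> carrier G"
    using g by auto
  then show ?case
    by simp
qed (use R in auto)

text \<open>This is von Dyck's theorem: evaluation is constant on congruence classes, so evaluating
  an arbitrarily chosen representative gives a well-defined map.\<close>

lemma (in group) presented_group_hom:
  assumes g: "g \<in> X \<rightarrow> carrier G"
    and R: "\<And>u v. (u, v) \<in> R \<Longrightarrow> u \<in> words X \<Longrightarrow> v \<in> words X \<Longrightarrow> word_value G g u = word_value G g v"
  obtains f where "f \<in> hom (presented_group X R) G"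
    "\<And>w. w \<in> words X \<Longrightarrow> f (word_class X R w) = word_value G g w"
proof -
  define f where "f A = word_value G g (SOME w. w \<in> A)" for A
  have f: "f (word_class X R w) = word_value G g w" if "w \<in> words X" for w
  proof -
    have "w \<in> word_class X R w"
      using that by (simp add: word_cong.refl)
    then have "(SOME v. v \<in> word_class X R w) \<in> word_class X R w"
      by (rule someI)
    then have "(w, SOME v. v \<in> word_class X R w) \<in> word_cong X R"
      by blast
    from word_value_word_cong[OF g R this] show ?thesis
      by (simp add: f_def)
  qed
  have "f \<in> hom (presented_group X R) G"
    by (rule homI)
      (use g in \<open>auto simp: carrier_presented_group f mult_presented_group word_value_append\<close>)
  then show ?thesis
    using f that by blast
qed

lemma presented_group_pow:
  assumes "x \<in> X"
  shows "word_class X R (letter x) [^]\<^bsub>presented_group X R\<^esub> (k::nat) = word_class X R (letter_power x k)"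
proof -
  interpret P: group "presented_group X R"
    by (rule group_presented_group)
  have "letter_power x k \<in> words X" for k
    using assms by (induction k) auto
  then show ?thesis
    using assms
    by (induction k) (auto simp: one_presented_group mult_presented_group replicate_append_same)
qed

lemma presented_group_inv_letter:
  assumes "x \<in> X"
  shows "word_class X R (inv_letter x) = inv\<^bsub>presented_group X R\<^esub> word_class X R (letter x)"
proof -
  interpret P: group "presented_group X R"
    by (rule group_presented_group)
  have "word_class X R (inv_letter x) \<otimes>\<^bsub>presented_group X R\<^esub> word_class X R (letter x) = \<one>\<^bsub>presented_group X R\<^esub>"
    using assms word_cong.cancel[of x X False R]
    by (simp add: mult_presented_group one_presented_group word_class_eq_iff)
  then show ?thesis
    using assms by (intro P.inv_equality[symmetric]) (auto simp: carrier_presented_group)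
qed

subsection \<open>The twisted group on the underlying set of the abelian group\<close>

locale twisted_setting =
  fixes p n :: nat and lam :: "nat \<Rightarrow> nat"
  assumes prime: "prime p" and n: "n \<ge> 2" and lam: "lam \<in> Lambda_plus n"
    and lam12: "lam 1 > lam 2" and lam3: "p = 2 \<Longrightarrow> lam 1 \<ge> 3"
begin

definition m :: "nat \<Rightarrow> int" where "m i = int (p ^ lam i)"

text \<open>Multiplication by \<open>q\<close> kills all coordinates except the first, where it
  leaves the subgroup of order \<open>p\<close>.\<close>

definition q :: int where "q = int (p ^ (lam 1 - 1))"

definition reduce :: "(nat \<Rightarrow> int) \<Rightarrow> nat \<Rightarrow> int" where
  "reduce x = (\<lambda>i\<in>{1..n}. x i mod m i)"

text \<open>The law is stated on unreduced integer vectors, so that the group axioms become integer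
  identities up to divisibility by \<open>m i\<close>. The extra term is a bilinear cocycle; since
  \<open>n\<close> differs from 1, coordinate \<open>n\<close> stays additive.\<close>

definition twist :: "(nat \<Rightarrow> int) \<Rightarrow> (nat \<Rightarrow> int) \<Rightarrow> nat \<Rightarrow> int" where
  "twist x y i = x i + y i + (if i = 1 then q * x n * y 1 else 0)"

definition twisted_model :: "(nat \<Rightarrow> int) monoid" where
  "twisted_model =
    \<lparr>carrier = \<Pi>\<^sub>E i\<in>{1..n}. {0..<m i},
     monoid.mult = (\<lambda>x y. reduce (twist x y)),
     one = reduce (\<lambda>_. 0)\<rparr>"

definition basis_vec :: "nat \<Rightarrow> nat \<Rightarrow> int" where
  "basis_vec i = reduce (\<lambda>j. if j = i then 1 else 0)"

lemma n_ne_1: "n \<noteq> 1" "n \<noteq> Suc 0" "n > 0"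
  using n by auto

lemma p_gt_1: "p > 1"
  using prime by (rule prime_gt_1_nat)

lemma lam_pos: "i \<in> {1..n} \<Longrightarrow> lam i > 0"
  using lam by (auto simp: Lambda_plus_def PiE_iff)

lemma lam_less: "i \<in> {2..n} \<Longrightarrow> lam i < lam 1"
  using lam lam12 n by (force simp: Lambda_plus_def)

lemma lam1_ge_2: "lam 1 \<ge> 2"
  using lam_less[of 2] lam_pos[of 2] n by auto

lemma m_pos: "m i > 0"
  using p_gt_1 by (simp add: m_def)

lemma m1_eq: "m 1 = int p * q"
  using lam1_ge_2 by (simp add: m_def q_def power_eq_if)

lemma p_dvd_q: "int p dvd q"
  using lam1_ge_2 by (simp add: q_def dvd_power)

lemma p_dvd_m: "i \<in> {1..n} \<Longrightarrow> int p dvd m i"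
  using lam_pos[of i] by (simp add: m_def dvd_power)

lemma m_dvd_q: "i \<in> {2..n} \<Longrightarrow> m i dvd q"
  using lam_less[of i] by (simp add: m_def q_def le_imp_power_dvd)

text \<open>As \<open>m 1\<close> is \<open>p\<close> times \<open>q\<close>, a multiple of
  \<open>q\<close> is determined modulo \<open>m 1\<close> by its cofactor modulo \<open>p\<close>.
  All corrections have this form, so they are controlled by divisibility by \<open>p\<close>
  alone.\<close>

lemma m1_dvd_q_mult_iff: "m 1 dvd q * a \<longleftrightarrow> int p dvd a"
  using p_gt_1 unfolding m1_eq by (simp add: mult.commute[of "int p"] q_def)

lemma reduce_in [simp]: "reduce x \<in> (\<Pi>\<^sub>E i\<in>{1..n}. {0..<m i})"
  by (auto simp: reduce_def m_pos)

lemma reduce_id: "x \<in> (\<Pi>\<^sub>E i\<in>{1..n}. {0..<m i}) \<Longrightarrow> reduce x = x"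
  by (rule ext) (auto simp: reduce_def PiE_iff extensional_def)

lemma reduce_eq_iff: "reduce x = reduce y \<longleftrightarrow> (\<forall>i\<in>{1..n}. m i dvd x i - y i)"
  by (auto simp: reduce_def fun_eq_iff mod_eq_dvd_iff)

lemma reduce_apply: "i \<in> {1..n} \<Longrightarrow> reduce x i = x i mod m i"
  by (simp add: reduce_def)

lemma reduce_twist: "reduce (twist (reduce x) (reduce y)) = reduce (twist x y)"
  unfolding reduce_eq_iff
proof
  fix i assume i: "i \<in> {1..n}"
  have dvd: "m j dvd reduce z j - z j" if "j \<in> {1..n}" for z j
    using that by (simp add: reduce_apply flip: mod_eq_dvd_iff)
  \<comment> \<open>The cocycle sees its arguments only modulo \<open>p\<close>, and reduction
    preserves these residues because \<open>p\<close> divides every \<open>m i\<close>.\<close>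
  have "m 1 dvd q * (reduce x n * reduce y 1 - x n * y 1)"
  proof -
    have "int p dvd (reduce x n - x n) * reduce y 1 + x n * (reduce y 1 - y 1)"
      using dvd_trans[OF p_dvd_m dvd, of n x] dvd_trans[OF p_dvd_m dvd, of 1 y] n
      by (intro dvd_add dvd_mult dvd_mult2) simp_all
    then show ?thesis
      unfolding m1_dvd_q_mult_iff by (simp add: algebra_simps)
  qed
  moreover have "m i dvd (reduce x i - x i) + (reduce y i - y i)"
    using dvd i by (intro dvd_add) auto
  ultimately have "m i dvd (reduce x i - x i) + (reduce y i - y i) +
      (if i = 1 then q * (reduce x n * reduce y 1 - x n * y 1) else 0)"
    by (auto intro: dvd_add)
  then show "m i dvd twist (reduce x) (reduce y) i - twist x y i"
    by (simp add: twist_def algebra_simps split: if_splits)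
qed

lemma carrier_twisted_model: "carrier twisted_model = range reduce"
proof
  show "carrier twisted_model \<subseteq> range reduce"
    using reduce_id by (metis (no_types, lifting) partial_object.select_convs(1) rangeI subsetI twisted_model_def)
qed (use reduce_in in \<open>auto simp: twisted_model_def\<close>)

lemma mult_twisted_model: "reduce x \<otimes>\<^bsub>twisted_model\<^esub> reduce y = reduce (twist x y)"
  by (simp add: twisted_model_def reduce_twist)

lemma one_twisted_model: "\<one>\<^bsub>twisted_model\<^esub> = reduce (\<lambda>_. 0)"
  by (simp add: twisted_model_def)

lemma finite_twisted_model: "finite (carrier twisted_model)"
  by (auto simp: twisted_model_def intro: finite_PiE)

lemma card_twisted_model: "card (carrier twisted_model) = (\<Prod>i=1..n. p ^ lam i)"
  by (simp add: twisted_model_def card_PiE m_def nat_power_eq)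

lemma group_twisted_model: "group twisted_model"
proof (rule groupI)
  fix X Y Z
  assume "X \<in> carrier twisted_model" "Y \<in> carrier twisted_model" "Z \<in> carrier twisted_model"
  then obtain x y z where XYZ: "X = reduce x" "Y = reduce y" "Z = reduce z"
    by (auto simp: carrier_twisted_model)
  \<comment> \<open>The two bracketings differ only in coordinate 1, by this term: the first
    coordinate of the product of y and z carries its own correction, which is then multiplied by
    \<open>q\<close> once more.\<close>
  have "m 1 dvd q * (q * (x n * (y n * z 1)))"
    using p_dvd_q by (subst m1_dvd_q_mult_iff) (rule dvd_mult2)
  then have "reduce (twist (twist x y) z) = reduce (twist x (twist y z))"
    unfolding reduce_eq_iff by (auto simp: twist_def n_ne_1 algebra_simps)
  then show "X \<otimes>\<^bsub>twisted_model\<^esub> Y \<otimes>\<^bsub>twisted_model\<^esub> Z = X \<otimes>\<^bsub>twisted_model\<^esub> (Y \<otimes>\<^bsub>twisted_model\<^esub> Z)"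
    by (simp add: XYZ mult_twisted_model)
next
  fix X assume "X \<in> carrier twisted_model"
  then obtain x where x: "X = reduce x"
    by (auto simp: carrier_twisted_model)
  \<comment> \<open>The added term compensates the correction \<open>q * (- x n) * x 1\<close>
    arising when the negated vector is multiplied by x.\<close>
  define y where "y i = - x i + (if i = 1 then q * x n * x 1 else 0)" for i
  have "twist y x = (\<lambda>_. 0)"
    by (auto simp: fun_eq_iff twist_def y_def n_ne_1 algebra_simps)
  then have "reduce y \<otimes>\<^bsub>twisted_model\<^esub> X = \<one>\<^bsub>twisted_model\<^esub>"
    by (simp add: x mult_twisted_model one_twisted_model)
  then show "\<exists>Y\<in>carrier twisted_model. Y \<otimes>\<^bsub>twisted_model\<^esub> X = \<one>\<^bsub>twisted_model\<^esub>"
    by (auto simp: carrier_twisted_model)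
  show "\<one>\<^bsub>twisted_model\<^esub> \<otimes>\<^bsub>twisted_model\<^esub> X = X"
    by (simp add: x one_twisted_model mult_twisted_model) (simp add: reduce_eq_iff twist_def)
qed (auto simp: carrier_twisted_model mult_twisted_model one_twisted_model)

sublocale T: group twisted_model
  by (rule group_twisted_model)

text \<open>Multiplying the j-th power by x contributes \<open>q * (j * x n) * x 1\<close>, and 0 +
  1 + ... + (k - 1) is \<open>k choose 2\<close>.\<close>

lemma pow_twisted_model:
  "reduce x [^]\<^bsub>twisted_model\<^esub> k =
   reduce (\<lambda>i. int k * x i + (if i = 1 then q * int (k choose 2) * x n * x 1 else 0))"
proof (induction k)
  case 0
  show ?case
    by (simp add: one_twisted_model numeral_2_eq_2 cong: if_cong)
next
  case (Suc k)
  have "twist (\<lambda>i. int k * x i + (if i = 1 then q * int (k choose 2) * x n * x 1 else 0)) x =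
    (\<lambda>i. int (Suc k) * x i + (if i = 1 then q * int (Suc k choose 2) * x n * x 1 else 0))"
    by (auto simp: fun_eq_iff twist_def n_ne_1 numeral_2_eq_2 algebra_simps)
  then show ?case
    by (simp add: Suc.IH mult_twisted_model)
qed

lemma basis_vec_in_carrier [simp]: "basis_vec i \<in> carrier twisted_model"
  by (simp add: basis_vec_def carrier_twisted_model)

lemma pow_basis_vec:
  "basis_vec i [^]\<^bsub>twisted_model\<^esub> (k::nat) = reduce (\<lambda>j. if j = i then int k else 0)"
  unfolding basis_vec_def pow_twisted_model
  by (rule arg_cong[of _ _ reduce]) (auto simp: fun_eq_iff n_ne_1)

lemma pow_basis_vec_m: "i \<in> {1..n} \<Longrightarrow> basis_vec i [^]\<^bsub>twisted_model\<^esub> (p ^ lam i) = \<one>\<^bsub>twisted_model\<^esub>"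
  by (auto simp: pow_basis_vec one_twisted_model reduce_eq_iff m_def)

lemma basis_vec_twist:
  "basis_vec n \<otimes>\<^bsub>twisted_model\<^esub> basis_vec 1 =
   basis_vec 1 [^]\<^bsub>twisted_model\<^esub> (1 + p ^ (lam 1 - 1)) \<otimes>\<^bsub>twisted_model\<^esub> basis_vec n"
  unfolding pow_basis_vec unfolding basis_vec_def mult_twisted_model
  by (rule arg_cong[of _ _ reduce]) (auto simp: fun_eq_iff twist_def n_ne_1 q_def)

lemma basis_vec_commute:
  assumes "{i, j} \<noteq> {1, n}"
  shows "basis_vec i \<otimes>\<^bsub>twisted_model\<^esub> basis_vec j = basis_vec j \<otimes>\<^bsub>twisted_model\<^esub> basis_vec i"
  unfolding basis_vec_def mult_twisted_model
  by (rule arg_cong[of _ _ reduce]) (use assms in \<open>auto simp: fun_eq_iff twist_def\<close>)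

lemma not_comm_twisted_model: "\<not> comm_group twisted_model"
proof
  assume "comm_group twisted_model"
  then have "basis_vec n \<otimes>\<^bsub>twisted_model\<^esub> basis_vec 1 = basis_vec 1 \<otimes>\<^bsub>twisted_model\<^esub> basis_vec n"
    by (simp add: comm_groupE(4))
  then have "m 1 dvd twist (\<lambda>j. if j = n then 1 else 0) (\<lambda>j. if j = 1 then 1 else 0) 1
      - twist (\<lambda>j. if j = 1 then 1 else 0) (\<lambda>j. if j = n then 1 else 0) 1"
    using n unfolding basis_vec_def mult_twisted_model reduce_eq_iff by auto
  then have "m 1 dvd q * 1"
    by (simp add: twist_def n_ne_1)
  then show False
    using p_gt_1 unfolding m1_dvd_q_mult_iff by simp
qed

text \<open>No correction ever appears: the n-th basis vector comes last, so the left factor always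
  has n-th coordinate 0. This is why the normal form puts \<open>a 1\<close> before
  \<open>a n\<close>.\<close>

lemma ordered_power_prod_basis_vec:
  assumes "\<And>i. i \<in> {1..n} \<Longrightarrow> x i \<ge> 0" "k \<le> n"
  shows "ordered_power_prod twisted_model basis_vec x k = reduce (\<lambda>j. if j \<in> {1..k} then x j else 0)"
  using assms(2)
proof (induction k)
  case 0
  show ?case
    by (simp add: one_twisted_model)
next
  case (Suc k)
  have "basis_vec (Suc k) [^]\<^bsub>twisted_model\<^esub> x (Suc k) =
        reduce (\<lambda>j. if j = Suc k then x (Suc k) else 0)"
    using Suc.prems assms(1)[of "Suc k"] pow_basis_vec[of "Suc k" "nat (x (Suc k))"]
    by (simp flip: int_pow_int cong: if_cong)
  moreover have "twist (\<lambda>j. if j \<in> {1..k} then x j else 0) (\<lambda>j. if j = Suc k then x (Suc k) else 0) =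
      (\<lambda>j. if j \<in> {1..Suc k} then x j else 0)"
    using Suc.prems by (auto simp: fun_eq_iff twist_def)
  ultimately show ?case
    using Suc by (simp add: mult_twisted_model del: atLeastAtMost_iff)
qed

text \<open>Normal forms give an upper bound for the order of the presented group, namely the order
  of the model; the universal property gives a homomorphism onto the model. A surjection onto a set
  at least as large as its finite domain is bijective.\<close>

lemma twisted_p_group_iso: "twisted_p_group p n lam \<cong> twisted_model"
proof -
  let ?X = "{1..n}" and ?R = "twisted_relations p n lam" and ?P = "twisted_p_group p n lam"
  have P_def: "?P = presented_group ?X ?R"
    by (simp add: twisted_p_group_def)
  interpret P: group ?P
    unfolding P_def by (rule group_presented_group)
  define a where "a i = word_class ?X ?R (letter i)" for i
  have a: "a i \<in> carrier ?P" if "i \<in> ?X" for i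
    using that by (auto simp: a_def P_def carrier_presented_group)
  have letter_power_words: "letter_power i k \<in> words ?X" if "i \<in> ?X" for i k
    using that by (induction k) auto
  have rel: "word_class ?X ?R u = word_class ?X ?R v"
    if "(u, v) \<in> ?R" "u \<in> words ?X" "v \<in> words ?X" for u v
    using that by (simp add: word_class_eq_iff word_cong.relation)
  have pow: "a i [^]\<^bsub>?P\<^esub> k = word_class ?X ?R (letter_power i k)" if "i \<in> ?X" for i k
    using presented_group_pow[OF that] by (simp add: a_def P_def)
  have a_pow: "a i [^]\<^bsub>?P\<^esub> (p ^ lam i) = \<one>\<^bsub>?P\<^esub>" if "i \<in> ?X" for i
    unfolding pow[OF that] unfolding P_def one_presented_group
    using that letter_power_words by (intro rel) (auto simp: twisted_relations_def)
  have a_comm: "a i \<otimes>\<^bsub>?P\<^esub> a j = a j \<otimes>\<^bsub>?P\<^esub> a i" if "i \<in> ?X" "j \<in> ?X" "{i, j} \<noteq> {1, n}" for i j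
  proof -
    have "(letter i @ letter j, letter j @ letter i) \<in> ?R"
      using that unfolding twisted_relations_def by blast
    then show ?thesis
      using that rel[of "letter i @ letter j" "letter j @ letter i"]
      by (simp add: a_def P_def mult_presented_group)
  qed
  have a_twist: "a n \<otimes>\<^bsub>?P\<^esub> a 1 = a 1 [^]\<^bsub>?P\<^esub> int (1 + p ^ (lam 1 - 1)) \<otimes>\<^bsub>?P\<^esub> a n"
  proof -
    have X: "n \<in> ?X" "1 \<in> ?X"
      using n by auto
    have "(letter n @ letter 1 @ inv_letter n, letter_power 1 (1 + p ^ (lam 1 - 1))) \<in> ?R"
      unfolding twisted_relations_def by blast
    from rel[OF this] have "a n \<otimes>\<^bsub>?P\<^esub> (a 1 \<otimes>\<^bsub>?P\<^esub> inv\<^bsub>?P\<^esub> a n) = a 1 [^]\<^bsub>?P\<^esub> (1 + p ^ (lam 1 - 1))"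
      using X letter_power_words[OF X(2)] unfolding pow[OF X(2)]
      by (simp add: a_def P_def mult_presented_group flip: presented_group_inv_letter)
    then have "a n \<otimes>\<^bsub>?P\<^esub> a 1 \<otimes>\<^bsub>?P\<^esub> inv\<^bsub>?P\<^esub> a n = a 1 [^]\<^bsub>?P\<^esub> int (1 + p ^ (lam 1 - 1))"
      using a[OF X(1)] a[OF X(2)] by (simp only: int_pow_int P.m_assoc P.inv_closed)
    then show ?thesis
      using a[OF X(1)] a[OF X(2)] P.inv_solve_right by (metis P.int_pow_closed P.m_closed)
  qed
  let ?S = "range (\<lambda>x. ordered_power_prod ?P a x n)"
  have S_step: "a i \<otimes>\<^bsub>?P\<^esub> s \<in> ?S" if "i \<in> ?X" "s \<in> ?S" for i s
    using that P.generator_mult_ordered_power_prod[OF n a a_comm a_twist] by blast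
  have S_closed: "s \<in> carrier ?P" if "s \<in> ?S" for s
    using that a by auto
  \<comment> \<open>Normal forms are shown to exhaust the group by reading a word from the right:
    each letter acts by left multiplication on a normal form and must produce another one.\<close>
  have S_steps: "a i [^]\<^bsub>?P\<^esub> k \<otimes>\<^bsub>?P\<^esub> s \<in> ?S" if "i \<in> ?X" "s \<in> ?S" for i s and k :: nat
  proof (induction k)
    case 0
    show ?case
      using that S_closed by simp
  next
    case (Suc k)
    have "a i [^]\<^bsub>?P\<^esub> Suc k \<otimes>\<^bsub>?P\<^esub> s = a i \<otimes>\<^bsub>?P\<^esub> (a i [^]\<^bsub>?P\<^esub> k \<otimes>\<^bsub>?P\<^esub> s)"
      unfolding P.nat_pow_Suc2[OF a[OF that(1)]]
      using a[OF that(1)] S_closed[OF that(2)] by (simp add: P.m_assoc)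
    then show ?case
      using S_step[OF that(1) Suc.IH] by (simp only:)
  qed
  have "word_class ?X ?R w \<in> ?S" if "w \<in> words ?X" for w
    using that
  proof (induction w)
    case Nil
    have "ordered_power_prod ?P a (\<lambda>_. 0) n = \<one>\<^bsub>?P\<^esub>"
      using a by (rule P.ordered_power_prod_zero)
    then show ?case
      by (auto simp: P_def one_presented_group)
  next
    case (Cons l w)
    obtain i b where l: "l = (i, b)"
      by (cases l)
    have i: "i \<in> ?X" and w: "w \<in> words ?X" and IH: "word_class ?X ?R w \<in> ?S"
      using Cons by (auto simp: l)
    have "word_class ?X ?R (l # w) = word_class ?X ?R [l] \<otimes>\<^bsub>?P\<^esub> word_class ?X ?R w"
      using i w by (simp add: P_def mult_presented_group l)
    \<comment> \<open>The generators have finite order, so an inverse letter is a natural power of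
      its generator and needs no commutation rules of its own.\<close>
    moreover have "\<exists>k::nat. word_class ?X ?R [l] = a i [^]\<^bsub>?P\<^esub> k"
    proof (cases b)
      case True
      then show ?thesis
        using a[OF i] by (intro exI[of _ 1]) (simp add: l a_def)
    next
      case False
      have "Suc (p ^ lam i - 1) = p ^ lam i"
        using p_gt_1 by simp
      then have "a i [^]\<^bsub>?P\<^esub> (p ^ lam i - 1) \<otimes>\<^bsub>?P\<^esub> a i = \<one>\<^bsub>?P\<^esub>"
        using a_pow[OF i] by (metis P.nat_pow_Suc)
      then have "inv\<^bsub>?P\<^esub> a i = a i [^]\<^bsub>?P\<^esub> (p ^ lam i - 1)"
        using a[OF i] by (intro P.inv_equality) auto
      then show ?thesis
        using False presented_group_inv_letter[OF i, of ?R] by (auto simp: l a_def P_def)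
    qed
    ultimately show ?case
      using S_steps[OF i IH] by auto
  qed
  then have carrier: "carrier ?P = ?S"
    using S_closed by (auto simp: P_def carrier_presented_group)
  have card: "finite (carrier ?P)" "card (carrier ?P) \<le> card (carrier twisted_model)"
  proof -
    have "a i [^]\<^bsub>?P\<^esub> int (p ^ lam i) = \<one>\<^bsub>?P\<^esub>" if "i \<in> ?X" for i
      using a_pow[OF that] by (simp only: int_pow_int)
    from P.card_ordered_power_prods_le[of n a "\<lambda>i. p ^ lam i", OF a this]
    show "finite (carrier ?P)" "card (carrier ?P) \<le> card (carrier twisted_model)"
      using p_gt_1 unfolding carrier card_twisted_model by simp_all
  qed
  have basis: "basis_vec \<in> ?X \<rightarrow> carrier twisted_model"
    by simp
  have "word_value twisted_model basis_vec u = word_value twisted_model basis_vec v"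
    if uv: "(u, v) \<in> ?R" for u v
  proof -
    consider i where "i \<in> ?X" "u = letter_power i (p ^ lam i)" "v = []"
      | "u = letter n @ letter 1 @ inv_letter n" "v = letter_power 1 (1 + p ^ (lam 1 - 1))"
      | i j where "u = letter i @ letter j" "v = letter j @ letter i" "{i, j} \<noteq> {1, n}"
      using uv unfolding twisted_relations_def by blast
    then show ?thesis
    proof cases
      case 1
      then show ?thesis
        using pow_basis_vec_m by (simp add: T.word_value_letter_power)
    next
      case 2
      have "basis_vec n \<otimes>\<^bsub>twisted_model\<^esub> basis_vec 1 \<otimes>\<^bsub>twisted_model\<^esub> inv\<^bsub>twisted_model\<^esub> basis_vec n =
            basis_vec 1 [^]\<^bsub>twisted_model\<^esub> (1 + p ^ (lam 1 - 1))"
        unfolding basis_vec_twist by (simp add: T.m_assoc)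
      then show ?thesis
        unfolding 2 T.word_value_letter_power[of basis_vec, OF basis_vec_in_carrier]
        by (simp add: T.m_assoc)
    next
      case 3
      then show ?thesis
        using basis_vec_commute[OF 3(3)] by simp
    qed
  qed
  then obtain f where f: "f \<in> hom ?P twisted_model"
    and f_word: "\<And>w. w \<in> words ?X \<Longrightarrow> f (word_class ?X ?R w) = word_value twisted_model basis_vec w"
    using T.presented_group_hom[OF basis, of ?R] unfolding P_def by metis
  interpret f: group_hom ?P twisted_model f
    using f by unfold_locales
  have f_a: "f (a i) = basis_vec i" if "i \<in> ?X" for i
    using that by (simp add: a_def f_word del: One_nat_def)
  \<comment> \<open>A vector x is the image of the normal form whose exponents are the coordinates
    of x.\<close>
  have "carrier twisted_model \<subseteq> f ` carrier ?P"
  proof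
    fix x assume x: "x \<in> carrier twisted_model"
    have "f (ordered_power_prod ?P a x n) = ordered_power_prod twisted_model basis_vec x n"
      using a f_a by (subst f.hom_ordered_power_prod) (auto intro: ordered_power_prod_cong)
    also have "\<dots> = reduce (\<lambda>j. if j \<in> {1..n} then x j else 0)"
      using x by (intro ordered_power_prod_basis_vec) (auto simp: twisted_model_def)
    also have "\<dots> = reduce x"
      by (auto simp: reduce_eq_iff)
    also have "\<dots> = x"
      using x by (auto simp: twisted_model_def reduce_id)
    finally show "x \<in> f ` carrier ?P"
      unfolding carrier by (metis (no_types, lifting) imageI rangeI)
  qed
  then have surj: "f ` carrier ?P = carrier twisted_model"
    by auto
  then have "inj_on f (carrier ?P)"
    using card card_image_le[OF card(1), of f] by (intro eq_card_imp_inj_on) auto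
  then have "f \<in> iso ?P twisted_model"
    using f surj by (auto simp: iso_def bij_betw_def)
  then show ?thesis
    by (auto simp: is_iso_def)
qed

end

section \<open>Equality of the subgroups of the twisted and the abelian group\<close>

lemma (in group) subgroup_nat_pow_closed:
  assumes "subgroup H G" "x \<in> H"
  shows "x [^] (k::nat) \<in> H"
  using subgroup_int_pow_closed[OF assms, of "int k"] by (simp add: int_pow_int)

context twisted_setting
begin

abbreviation untwisted_model :: "(nat \<Rightarrow> int) monoid" where
  "untwisted_model \<equiv> abelian_p_group p n lam"

lemma carrier_untwisted_model: "carrier untwisted_model = carrier twisted_model"
  using p_gt_1 by (auto simp: abelian_p_group_def twisted_model_def carrier_integer_mod_group m_def)

lemma mult_untwisted_model:
  "reduce x \<otimes>\<^bsub>untwisted_model\<^esub> reduce y = reduce (\<lambda>i. x i + y i)"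
  by (auto simp: abelian_p_group_def reduce_def m_def fun_eq_iff mod_add_eq)

lemma one_untwisted_model: "\<one>\<^bsub>untwisted_model\<^esub> = reduce (\<lambda>_. 0)"
  by (auto simp: abelian_p_group_def reduce_def)

lemma group_untwisted_model: "group untwisted_model"
  by (simp add: abelian_p_group_def)

lemma pow_untwisted_model:
  "reduce x [^]\<^bsub>untwisted_model\<^esub> k = reduce (\<lambda>i. int k * x i)" for k :: nat
proof (induction k)
  case 0
  show ?case
    by (simp add: one_untwisted_model)
next
  case (Suc k)
  then show ?case
    by (simp add: mult_untwisted_model algebra_simps)
qed

text \<open>This is the t-th power of the element \<open>c\<close> from the overview; it depends
  only on t modulo \<open>p\<close>.\<close>

definition central :: "int \<Rightarrow> nat \<Rightarrow> int" where
  "central t = reduce (\<lambda>i. if i = 1 then q * t else 0)"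

lemma twisted_mult_eq:
  assumes "X \<in> carrier twisted_model" "Y \<in> carrier twisted_model"
  shows "X \<otimes>\<^bsub>twisted_model\<^esub> Y = (X \<otimes>\<^bsub>untwisted_model\<^esub> Y) \<otimes>\<^bsub>untwisted_model\<^esub> central (X n * Y 1)"
proof -
  have [simp]: "reduce X = X" "reduce Y = Y"
    using assms by (auto simp: twisted_model_def reduce_id)
  have "reduce X \<otimes>\<^bsub>twisted_model\<^esub> reduce Y =
      (reduce X \<otimes>\<^bsub>untwisted_model\<^esub> reduce Y) \<otimes>\<^bsub>untwisted_model\<^esub> central (X n * Y 1)"
    unfolding mult_twisted_model mult_untwisted_model central_def
    by (rule arg_cong[of _ _ reduce]) (auto simp: fun_eq_iff twist_def)
  then show ?thesis
    by simp
qed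

lemma untwisted_mult_eq:
  assumes "X \<in> carrier twisted_model" "Y \<in> carrier twisted_model"
  shows "X \<otimes>\<^bsub>untwisted_model\<^esub> Y = (X \<otimes>\<^bsub>twisted_model\<^esub> Y) \<otimes>\<^bsub>twisted_model\<^esub> central (- (X n * Y 1))"
proof -
  have [simp]: "reduce X = X" "reduce Y = Y"
    using assms by (auto simp: twisted_model_def reduce_id)
  \<comment> \<open>Removing the correction inside the twisted group creates a secondary correction,
    which has a factor \<open>q * q\<close> and hence vanishes modulo \<open>m 1\<close>.\<close>
  have "m 1 dvd q * (q * ((X n + Y n) * (X n * Y 1)))"
    using p_dvd_q by (subst m1_dvd_q_mult_iff) (rule dvd_mult2)
  then have "reduce X \<otimes>\<^bsub>untwisted_model\<^esub> reduce Y =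
      (reduce X \<otimes>\<^bsub>twisted_model\<^esub> reduce Y) \<otimes>\<^bsub>twisted_model\<^esub> central (- (X n * Y 1))"
    unfolding mult_twisted_model mult_untwisted_model central_def reduce_eq_iff
    by (auto simp: twist_def n_ne_1 algebra_simps)
  then show ?thesis
    by simp
qed

lemma twisted_mult_eq_untwisted:
  assumes "X \<in> carrier twisted_model" "Y \<in> carrier twisted_model" "int p dvd Y 1"
  shows "X \<otimes>\<^bsub>twisted_model\<^esub> Y = X \<otimes>\<^bsub>untwisted_model\<^esub> Y"
proof -
  have "m 1 dvd q * (X n * Y 1)"
    using assms(3) by (subst m1_dvd_q_mult_iff) (rule dvd_mult)
  then have "central (X n * Y 1) = \<one>\<^bsub>untwisted_model\<^esub>"
    by (auto simp: central_def one_untwisted_model reduce_eq_iff)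
  then show ?thesis
    using twisted_mult_eq[OF assms(1,2)] group.is_monoid[OF group_untwisted_model] assms(1,2)
    by (metis carrier_untwisted_model monoid.m_closed monoid.r_one)
qed

text \<open>Inverting \<open>a\<close> modulo \<open>p\<close> solves the congruence; a non-negative
  solution is chosen because it will be used as an exponent of a natural power.\<close>

lemma unit_multiple:
  assumes "\<not> int p dvd a"
  obtains k :: nat where "int p dvd int k * a - t"
proof -
  have "coprime a (int p)"
    using assms prime by (metis coprime_commute prime_imp_coprime prime_nat_int_transfer)
  then obtain r where r: "[a * r = 1] (mod int p)"
    using cong_solve_coprime_int by blast
  define k where "k = nat ((r * t) mod int p)"
  have "int k = (r * t) mod int p"
    using p_gt_1 by (simp add: k_def)
  then have "[int k * a = (r * t) * a] (mod int p)"
    by (simp add: cong_def mod_mult_left_eq)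
  also have "[(r * t) * a = 1 * t] (mod int p)"
    using cong_scalar_right[OF r, of t] by (simp add: mult_ac)
  finally show ?thesis
    using that by (simp add: cong_iff_dvd_diff)
qed

text \<open>Raising X to the power \<open>p ^ (lam 1 - 1) * k\<close> kills the coordinates from 2
  on, since \<open>m i\<close> divides \<open>q\<close> there, and leaves \<open>q * k * X 1\<close>
  in the first; k is chosen so that this agrees with \<open>q * t\<close> modulo
  \<open>m 1\<close>.\<close>

lemma untwisted_central_in_subgroup:
  assumes H: "subgroup H untwisted_model" and X: "X \<in> H" "\<not> int p dvd X 1"
  shows "central t \<in> H"
proof -
  interpret U: group untwisted_model
    by (rule group_untwisted_model)
  obtain k where k: "int p dvd int k * X 1 - t"
    using unit_multiple[OF X(2)] .
  have "X \<in> carrier untwisted_model"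
    using H X(1) by (rule subgroup.mem_carrier)
  then have "reduce X = X"
    by (auto simp: carrier_untwisted_model twisted_model_def reduce_id)
  then have "X [^]\<^bsub>untwisted_model\<^esub> (p ^ (lam 1 - 1) * k) = reduce (\<lambda>i. q * int k * X i)"
    using pow_untwisted_model[of X "p ^ (lam 1 - 1) * k"] by (simp add: q_def)
  also have "\<dots> = central t"
    unfolding central_def reduce_eq_iff
  proof
    fix i assume i: "i \<in> {1..n}"
    show "m i dvd q * int k * X i - (if i = 1 then q * t else 0)"
    proof (cases "i = 1")
      case True
      have "q * int k * X 1 - q * t = q * (int k * X 1 - t)"
        by (simp add: algebra_simps)
      then show ?thesis
        using True k m1_dvd_q_mult_iff by simp
    next
      case False
      then show ?thesis
        using i m_dvd_q[of i] by (simp add: dvd_mult2 mult.assoc)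
    qed
  qed
  finally show ?thesis
    using U.subgroup_nat_pow_closed[OF H X(1)] by metis
qed

text \<open>For odd \<open>p\<close>, the prime divides twice the binomial coefficient and not 2.
  For \<open>p = 2\<close> the coefficient is 2^(lam 1 - 2) times an odd number, and
  \<open>lam 1 \<ge> 3\<close> makes it even.\<close>

lemma p_dvd_choose_2: "p dvd (p ^ (lam 1 - 1)) choose 2"
proof (cases "p = 2")
  case True
  obtain l where l: "lam 1 = Suc (Suc (Suc l))"
    using lam3[OF True] by (metis add_2_eq_Suc add_Suc le_Suc_ex numeral_3_eq_3 add.commute One_nat_def plus_1_eq_Suc)
  show ?thesis
    unfolding choose_two by (simp add: True l[unfolded One_nat_def])
next
  case False
  have "p dvd p ^ (lam 1 - 1) * (p ^ (lam 1 - 1) - 1)"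
    using lam1_ge_2 by (simp add: dvd_power dvd_mult2)
  also have "\<dots> = 2 * (p ^ (lam 1 - 1) choose 2)"
    unfolding choose_two by (rule dvd_mult_div_cancel[symmetric]) auto
  finally show ?thesis
    using prime False by (metis prime_dvd_mult_iff primes_dvd_imp_eq two_is_prime_nat)
qed

text \<open>The same power works as in the abelian case once the binomial term vanishes. It is taken
  in two stages: the first exponent is where the binomial coefficient is known to be divisible by
  \<open>p\<close>, and the second acts on an element with n-th coordinate 0, which produces no
  correction.\<close>

lemma twisted_central_in_subgroup:
  assumes H: "subgroup H twisted_model" and X: "X \<in> H" "\<not> int p dvd X 1"
  shows "central t \<in> H"
proof -
  let ?Q = "p ^ (lam 1 - 1)"
  obtain k where k: "int p dvd int k * X 1 - t"
    using unit_multiple[OF X(2)] .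
  have "X \<in> carrier twisted_model"
    using H X(1) by (rule subgroup.mem_carrier)
  then have "reduce X = X"
    by (auto simp: twisted_model_def reduce_id)
  then have "X [^]\<^bsub>twisted_model\<^esub> ?Q =
      reduce (\<lambda>i. q * X i + (if i = 1 then q * int (?Q choose 2) * X n * X 1 else 0))"
    using pow_twisted_model[of X ?Q] by (simp add: q_def cong: if_cong)
  also have "\<dots> = central (X 1)"
    unfolding central_def reduce_eq_iff
  proof
    fix i assume i: "i \<in> {1..n}"
    have "int p dvd int (?Q choose 2) * (X n * X 1)"
      using p_dvd_choose_2 by (intro dvd_mult2) (simp only: int_dvd_int_iff)
    then have "m 1 dvd q * (int (?Q choose 2) * (X n * X 1))"
      by (simp only: m1_dvd_q_mult_iff)
    then show "m i dvd q * X i + (if i = 1 then q * int (?Q choose 2) * X n * X 1 else 0)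
        - (if i = 1 then q * X 1 else 0)"
      using i m_dvd_q[of i] by (cases "i = 1") (auto simp: mult.assoc)
  qed
  finally have "central (X 1) \<in> H"
    using T.subgroup_nat_pow_closed[OF H X(1)] by metis
  then have "central (X 1) [^]\<^bsub>twisted_model\<^esub> k \<in> H"
    by (rule T.subgroup_nat_pow_closed[OF H])
  also have "central (X 1) [^]\<^bsub>twisted_model\<^esub> k = central t"
  proof -
    have "m 1 dvd q * (int k * X 1 - t)"
      using k by (simp only: m1_dvd_q_mult_iff)
    then show ?thesis
      unfolding central_def pow_twisted_model reduce_eq_iff
      by (auto simp: n_ne_1 algebra_simps)
  qed
  finally show ?thesis .
qed

text \<open>By finiteness only closure under the other product is at stake. The case split is made
  for each product: either \<open>p\<close> divides the first coordinate of the right factor Y and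
  the two products coincide, or Y itself forces the correcting central element into H.\<close>

lemma subgroup_twisted_iff_untwisted:
  "subgroup H twisted_model \<longleftrightarrow> subgroup H untwisted_model"
proof
  assume H: "subgroup H untwisted_model"
  have sub: "H \<subseteq> carrier twisted_model"
    using subgroup.subset[OF H] by (simp add: carrier_untwisted_model)
  show "subgroup H twisted_model"
  proof (rule T.finite_mult_closed_imp_subgroup[OF finite_twisted_model sub])
    show "H \<noteq> {}"
      using subgroup.one_closed[OF H] by blast
    fix X Y assume XY: "X \<in> H" "Y \<in> H"
    show "X \<otimes>\<^bsub>twisted_model\<^esub> Y \<in> H"
    proof (cases "int p dvd Y 1")
      case True
      then show ?thesis
        using twisted_mult_eq_untwisted[OF subsetD[OF sub XY(1)] subsetD[OF sub XY(2)] True]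
          subgroup.m_closed[OF H XY] by simp
    next
      case False
      then show ?thesis
        using untwisted_central_in_subgroup[OF H XY(2)] XY sub
        by (subst twisted_mult_eq) (auto intro!: subgroup.m_closed[OF H])
    qed
  qed
next
  assume H: "subgroup H twisted_model"
  interpret U: group untwisted_model
    by (rule group_untwisted_model)
  have sub: "H \<subseteq> carrier twisted_model"
    using subgroup.subset[OF H] .
  show "subgroup H untwisted_model"
  proof (rule U.finite_mult_closed_imp_subgroup)
    show "finite (carrier untwisted_model)" "H \<subseteq> carrier untwisted_model"
      using sub finite_twisted_model by (simp_all add: carrier_untwisted_model)
    show "H \<noteq> {}"
      using subgroup.one_closed[OF H] by blast
    fix X Y assume XY: "X \<in> H" "Y \<in> H"
    show "X \<otimes>\<^bsub>untwisted_model\<^esub> Y \<in> H"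
    proof (cases "int p dvd Y 1")
      case True
      then show ?thesis
        using twisted_mult_eq_untwisted[OF subsetD[OF sub XY(1)] subsetD[OF sub XY(2)] True]
          subgroup.m_closed[OF H XY] by simp
    next
      case False
      then show ?thesis
        using twisted_central_in_subgroup[OF H XY(2)] XY sub
        by (subst untwisted_mult_eq) (auto intro!: subgroup.m_closed[OF H])
    qed
  qed
qed

lemma group_twisted_p_group: "group (twisted_p_group p n lam)"
  unfolding twisted_p_group_def by (rule group_presented_group)

lemma finite_twisted_p_group: "finite (carrier (twisted_p_group p n lam))"
  using twisted_p_group_iso finite_twisted_model
  by (auto simp: is_iso_def iso_def dest: bij_betw_finite)

lemma not_comm_twisted_p_group: "\<not> comm_group (twisted_p_group p n lam)"
  using comm_group.iso_imp_comm_group[OF _ twisted_p_group_iso T.is_monoid] not_comm_twisted_model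
  by blast

lemma group_zeta_twisted_p_group:
  "group_zeta (twisted_p_group p n lam) = group_zeta (abelian_p_group p n lam)"
proof (rule group_zeta_cong)
  fix k
  have "subgroup_count twisted_model k = subgroup_count untwisted_model k"
    by (simp add: subgroup_count_def subgroup_twisted_iff_untwisted)
  then show "subgroup_count (twisted_p_group p n lam) k = subgroup_count (abelian_p_group p n lam) k"
    using subgroup_count_iso[OF group_twisted_p_group group_twisted_model twisted_p_group_iso] by simp
qed

end

subsection \<open>Counting subgroups\<close>

lemma (in group) card_subgroup_dvd_card_subgroup:
  assumes "subgroup K G" "subgroup H G" "K \<subseteq> H"
  shows "card K dvd card H"
proof -
  interpret H: group "G\<lparr>carrier := H\<rparr>"
    by (rule subgroup_imp_group) fact
  show ?thesis
    using H.lagrange[OF subgroup_incl[OF assms]] by (simp add: Coset.order_def) (metis dvd_triv_right)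
qed

lemma (in group) generate_singleton_subset:
  "subgroup H G \<Longrightarrow> x \<in> H \<Longrightarrow> generate G {x} \<subseteq> H"
  by (rule generate_subgroup_incl) auto

lemma (in group) ord_dvd_card_subgroup:
  assumes "subgroup H G" "x \<in> H"
  shows "ord x dvd card H"
proof -
  have "x \<in> carrier G"
    using assms by (rule subgroup.mem_carrier)
  then show ?thesis
    using card_subgroup_dvd_card_subgroup[OF generate_is_subgroup assms(1) generate_singleton_subset[OF assms]]
    by (simp add: generate_pow_card)
qed

lemma (in group) card_subgroup_dvd:
  "subgroup H G \<Longrightarrow> card H dvd card (carrier G)"
  by (rule card_subgroup_dvd_card_subgroup[OF _ subgroup_self subgroup.subset])

lemma card_eq_card_times_fiber:
  assumes "finite S" "finite T" "f ` S \<subseteq> T" "\<And>y. y \<in> T \<Longrightarrow> card {x \<in> S. f x = y} = k"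
  shows "card S = card T * k"
proof -
  have "card S = card (\<Union>y\<in>T. {x \<in> S. f x = y})"
    using assms(3) by (intro arg_cong[of _ _ card]) auto
  also have "\<dots> = (\<Sum>y\<in>T. card {x \<in> S. f x = y})"
    using assms by (intro card_UN_disjoint) auto
  finally show ?thesis
    using assms(4) by simp
qed

section \<open>Cyclic groups and uniqueness of subgroups of given order\<close>

lemma sum_powers_less:
  fixes p :: nat
  assumes "p \<ge> 2"
  shows "(\<Sum>k<l. p ^ k) < p ^ l"
proof (induction l)
  case (Suc l)
  have "p ^ l + p ^ l \<le> p * p ^ l"
    using mult_le_mono1[OF assms, of "p ^ l"] by (simp only: mult_2)
  then show ?case
    using Suc by simp
qed simp

text \<open>All elements of order \<open>p ^ k\<close> generate the same subgroup and therefore lie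
  in it, so there are at most \<open>p ^ k\<close> of them. This crude bound suffices: the sum of
  the smaller powers of \<open>p\<close> stays below \<open>p ^ l\<close>, so some element has order
  \<open>p ^ l\<close>.\<close>

lemma (in group) cyclic_if_unique_subgroups:
  assumes p: "prime p" and fin: "finite (carrier G)" and card: "card (carrier G) = p ^ l"
    and count: "\<And>k. subgroup_count G (p ^ k) \<le> 1"
  obtains g where "g \<in> carrier G" "ord g = p ^ l"
proof (rule ccontr)
  assume "\<not> thesis"
  then have no_gen: "ord x \<noteq> p ^ l" if "x \<in> carrier G" for x
    using that that[THEN \<open>\<And>g. g \<in> carrier G \<Longrightarrow> ord g = p ^ l \<Longrightarrow> thesis\<close>] by blast
  define F where "F k = {x \<in> carrier G. ord x = p ^ k}" for k
  have "card (F k) \<le> p ^ k" for k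
  proof (cases "F k = {}")
    case False
    then obtain x where x: "x \<in> carrier G" "ord x = p ^ k"
      by (auto simp: F_def)
    have "F k \<subseteq> generate G {x}"
    proof
      fix y assume "y \<in> F k"
      then have y: "y \<in> carrier G" "ord y = p ^ k"
        by (auto simp: F_def)
      have "generate G {x} = generate G {y}"
        using count[of k] x y finite_subgroups[OF fin, of "p ^ k"] generate_is_subgroup
        by (auto simp: subgroup_count_def card_le_Suc0_iff_eq generate_pow_card)
      then show "y \<in> generate G {x}"
        by (auto intro: generate.incl)
    qed
    moreover have "finite (generate G {x})"
      using x generate_incl[of "{x}"] by (intro finite_subset[OF _ fin]) auto
    ultimately show ?thesis
      using x by (metis card_mono generate_pow_card)
  qed auto
  then have "(\<Sum>k<l. card (F k)) \<le> (\<Sum>k<l. p ^ k)"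
    by (intro sum_mono) auto
  moreover have "carrier G \<subseteq> (\<Union>k<l. F k)"
  proof
    fix x assume x: "x \<in> carrier G"
    then have "ord x dvd p ^ l"
      using ord_dvd_group_order[OF x] by (simp add: Coset.order_def card)
    then obtain k where "k \<le> l" "ord x = p ^ k"
      using p by (auto simp: divides_primepow_nat)
    moreover have "k \<noteq> l"
      using no_gen[OF x] calculation by auto
    ultimately show "x \<in> (\<Union>k<l. F k)"
      using x by (auto simp: F_def)
  qed
  then have "p ^ l \<le> card (\<Union>k<l. F k)"
    unfolding card[symmetric] by (rule card_mono[rotated]) (auto simp: F_def fin)
  moreover have "card (\<Union>k<l. F k) \<le> (\<Sum>k<l. card (F k))"
    by (rule card_UN_le) simp
  ultimately show False
    using sum_powers_less[of p l] prime_ge_2_nat[OF p] by linarith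
qed

text \<open>If N is the order of the group and h that of H, an element \<open>g [^] j\<close> of H
  is killed by h, so N divides j h and N / h divides j. Hence H lies in the subgroup generated by
  the power of \<open>g\<close> with exponent N / h, which also has order h.\<close>

lemma (in group) subgroup_count_le_1_if_cyclic:
  assumes fin: "finite (carrier G)" and g: "g \<in> carrier G" "ord g = card (carrier G)"
  shows "subgroup_count G m \<le> 1"
proof -
  have gen: "generate G {g} = carrier G"
    using g fin generate_in_carrier[of "{g}"] by (intro card_subset_eq) (auto simp: generate_pow_card)
  have "H = generate G {g [^] (card (carrier G) div card H)}" if H: "subgroup H G" for H
  proof -
    define d where "d = card (carrier G) div card H"
    have N: "card (carrier G) = d * card H" and "card (carrier G) > 0"
      using card_subgroup_dvd[OF H] fin one_closed by (auto simp: d_def card_gt_0_iff)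
    then have pos: "d > 0" "card H > 0"
      by auto
    have gd: "g [^] d \<in> carrier G"
      using g by simp
    have "H \<subseteq> generate G {g [^] d}"
    proof
      fix x assume x: "x \<in> H"
      then have "x \<in> generate G {g}"
        using subgroup.subset[OF H] gen by auto
      then obtain j :: int where j: "x = g [^] j"
        using generate_pow[OF g(1)] by auto
      have "x [^] card H = \<one>"
        using ord_dvd_card_subgroup[OF H x] subgroup.mem_carrier[OF H x] by (simp add: pow_eq_id)
      then have "g [^] (j * int (card H)) = \<one>"
        using g(1) by (simp add: j int_pow_pow flip: int_pow_int)
      then have "int d * int (card H) dvd j * int (card H)"
        using g N by (simp add: int_pow_eq_id)
      then have "int d dvd j"
        using pos by simp
      then obtain i where "j = int d * i"
        by (rule dvdE)
      then have "x = (g [^] d) [^] i"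
        using g(1) by (simp add: j int_pow_pow flip: int_pow_int)
      then show "x \<in> generate G {g [^] d}"
        using generate_pow[OF gd] by auto
    qed
    moreover have "card (generate G {g [^] d}) = card H"
    proof -
      have "ord (g [^] d) = card H"
        using ord_pow[OF g(1), of d] g(2) N pos by simp
      then show ?thesis
        using generate_pow_card[OF gd] by simp
    qed
    moreover have "finite (generate G {g [^] d})"
      using gd generate_incl[of "{g [^] d}"] by (intro finite_subset[OF _ fin]) auto
    ultimately show ?thesis
      unfolding d_def[symmetric] by (metis card_subset_eq)
  qed
  then have "H = K" if "subgroup H G" "subgroup K G" "card H = card K" for H K
    using that by metis
  then show ?thesis
    using finite_subgroups[OF fin, of m]
    unfolding subgroup_count_def One_nat_def by (subst card_le_Suc0_iff_eq) blast+
qed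

text \<open>Every element of order \<open>p\<close> generates the unique subgroup of order
  \<open>p\<close> containing it, and conversely all nontrivial elements of such a subgroup generate
  it.\<close>

lemma (in group) card_elements_of_prime_order:
  assumes p: "prime p" and fin: "finite (carrier G)"
  shows "card {x \<in> carrier G. ord x = p} = subgroup_count G p * (p - 1)"
  unfolding subgroup_count_def
proof (rule card_eq_card_times_fiber[where f = "\<lambda>x. generate G {x}"])
  show "(\<lambda>x. generate G {x}) ` {x \<in> carrier G. ord x = p} \<subseteq> {H. subgroup H G \<and> card H = p}"
    using generate_is_subgroup by (auto simp: generate_pow_card)
  fix H assume "H \<in> {H. subgroup H G \<and> card H = p}"
  then have H: "subgroup H G" "card H = p"
    by auto
  have finH: "finite H"
    using subgroup.subset[OF H(1)] fin by (rule finite_subset)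
  have "{x \<in> {x \<in> carrier G. ord x = p}. generate G {x} = H} = H - {\<one>}"
  proof (intro equalityI subsetI)
    fix x assume "x \<in> {x \<in> {x \<in> carrier G. ord x = p}. generate G {x} = H}"
    then show "x \<in> H - {\<one>}"
      using p by (auto intro: generate.incl dest: ord_eq_1[THEN iffD2])
  next
    fix x assume x: "x \<in> H - {\<one>}"
    then have xG: "x \<in> carrier G"
      using subgroup.mem_carrier[OF H(1)] by blast
    have "ord x dvd p" "ord x \<noteq> 1"
      using ord_dvd_card_subgroup[of H x] H x xG ord_eq_1 by auto
    then have "ord x = p"
      using p by (auto simp: prime_nat_iff)
    moreover have "generate G {x} = H"
      using generate_singleton_subset[of H x] H x xG finH \<open>ord x = p\<close>
      by (intro card_subset_eq) (auto simp: generate_pow_card)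
    ultimately show "x \<in> {x \<in> {x \<in> carrier G. ord x = p}. generate G {x} = H}"
      using xG by auto
  qed
  then show "card {x \<in> {x \<in> carrier G. ord x = p}. generate G {x} = H} = p - 1"
    using H finH subgroup.one_closed[OF H(1)] by simp
qed (use fin finite_subgroups in auto)

section \<open>Groups of prime exponent: pairs of elements and subgroups of order
  \<open>p\<^sup>2\<close>\<close>

locale finite_exponent_group = group +
  fixes p :: nat
  assumes prime: "prime p" and fin: "finite (carrier G)"
    and ord: "\<And>x. x \<in> carrier G \<Longrightarrow> x \<noteq> \<one> \<Longrightarrow> ord x = p"
begin

lemma card_generate: "x \<in> carrier G \<Longrightarrow> x \<noteq> \<one> \<Longrightarrow> card (generate G {x}) = p"
  using ord generate_pow_card by metis

lemma finite_generate: "A \<subseteq> carrier G \<Longrightarrow> finite (generate G A)"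
  using generate_incl fin by (rule finite_subset)

lemma generate_eq:
  assumes "x \<in> carrier G" "y \<in> generate G {x}" "y \<noteq> \<one>"
  shows "generate G {y} = generate G {x}"
proof -
  have sub: "subgroup (generate G {x}) G"
    using assms by (intro generate_is_subgroup) auto
  have y: "y \<in> carrier G"
    using subgroup.mem_carrier[OF sub assms(2)] .
  have "x \<noteq> \<one>"
    using assms generate_one by auto
  then show ?thesis
    using assms y finite_generate[of "{x}"] generate_singleton_subset[OF sub assms(2)]
    by (intro card_subset_eq) (auto simp: card_generate)
qed

text \<open>These are the analogues of ordered pairs of linearly independent vectors. Their number
  is fixed by \<open>p\<close> and the order of the group, commutative or not, so it can be compared
  across groups.\<close>

definition independent_pairs :: "('a \<times> 'a) set" where
  "independent_pairs = (SIGMA x:carrier G - {\<one>}. carrier G - generate G {x})"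

definition planar_pairs :: "('a \<times> 'a) set" where
  "planar_pairs = {(x, y) \<in> independent_pairs. card (generate G {x, y}) = p\<^sup>2}"

lemma finite_independent_pairs: "finite independent_pairs"
  unfolding independent_pairs_def using fin by auto

lemma card_independent_pairs:
  "card independent_pairs = (card (carrier G) - 1) * (card (carrier G) - p)"
proof -
  have "card (carrier G - generate G {x}) = card (carrier G) - p" if "x \<in> carrier G - {\<one>}" for x
    using that card_generate[of x] finite_generate[of "{x}"] generate_incl[of "{x}"]
    by (simp add: card_Diff_subset)
  then show ?thesis
    using fin unfolding independent_pairs_def by (subst card_SigmaI) auto
qed

text \<open>Each subgroup of order \<open>p\<^sup>2\<close> is generated by precisely its own
  independent pairs, counted like the ordered bases of a plane over the field with \<open>p\<close>
  elements.\<close>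

lemma card_planar_pairs:
  "card planar_pairs = subgroup_count G (p\<^sup>2) * ((p\<^sup>2 - 1) * (p\<^sup>2 - p))"
  unfolding subgroup_count_def
proof (rule card_eq_card_times_fiber[where f = "\<lambda>(x, y). generate G {x, y}"])
  show "finite planar_pairs"
    by (rule finite_subset[OF _ finite_independent_pairs]) (auto simp: planar_pairs_def)
  show "(\<lambda>(x, y). generate G {x, y}) ` planar_pairs \<subseteq> {H. subgroup H G \<and> card H = p\<^sup>2}"
    by (auto simp: planar_pairs_def independent_pairs_def intro!: generate_is_subgroup)
  fix H assume "H \<in> {H. subgroup H G \<and> card H = p\<^sup>2}"
  then have H: "subgroup H G" "card H = p\<^sup>2"
    by auto
  have HG: "H \<subseteq> carrier G"
    using subgroup.subset[OF H(1)] .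
  then have finH: "finite H"
    using fin by (rule finite_subset)
  have "{z \<in> planar_pairs. (case z of (x, y) \<Rightarrow> generate G {x, y}) = H} =
      (SIGMA x:H - {\<one>}. H - generate G {x})"
  proof (intro equalityI subsetI)
    fix z assume "z \<in> {z \<in> planar_pairs. (case z of (x, y) \<Rightarrow> generate G {x, y}) = H}"
    then show "z \<in> (SIGMA x:H - {\<one>}. H - generate G {x})"
      by (auto simp: planar_pairs_def independent_pairs_def intro: generate.incl)
  next
    fix z assume "z \<in> (SIGMA x:H - {\<one>}. H - generate G {x})"
    then obtain x y where z: "z = (x, y)" and x: "x \<in> H" "x \<noteq> \<one>" and y: "y \<in> H" "y \<notin> generate G {x}"
      by auto
    have xyG: "x \<in> carrier G" "y \<in> carrier G"
      using x y HG by auto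
    then have K: "subgroup (generate G {x, y}) G"
      by (intro generate_is_subgroup) auto
    have KH: "generate G {x, y} \<subseteq> H"
      using x y H by (intro generate_subgroup_incl) auto
    then have "card (generate G {x, y}) dvd p\<^sup>2"
      using card_subgroup_dvd_card_subgroup[OF K H(1)] H(2) by simp
    then obtain i where i: "i \<le> 2" "card (generate G {x, y}) = p ^ i"
      using prime by (auto simp: divides_primepow_nat)
    \<comment> \<open>Strict inclusion makes the order exceed \<open>p\<close>, so as a divisor of
      \<open>p\<^sup>2\<close> it can only be \<open>p\<^sup>2\<close>.\<close>
    have "generate G {x} \<subset> generate G {x, y}"
      using y mono_generate[of "{x}" "{x, y}"] generate.incl[of y "{x, y}" G] by auto
    then have "p ^ 1 < p ^ i"
      using psubset_card_mono[OF finite_generate, of "{x, y}" "generate G {x}"] xyG x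
      by (simp add: card_generate i(2)[symmetric])
    then have "1 < i"
      using prime_gt_1_nat[OF prime] power_less_imp_less_exp by blast
    then have "card (generate G {x, y}) = p\<^sup>2"
      using i by (metis Suc_1 Suc_leI le_antisym)
    moreover have "generate G {x, y} = H"
      using KH finH H calculation by (intro card_subset_eq) auto
    ultimately show "z \<in> {z \<in> planar_pairs. (case z of (x, y) \<Rightarrow> generate G {x, y}) = H}"
      using z x y xyG by (auto simp: planar_pairs_def independent_pairs_def)
  qed
  moreover have "card (SIGMA x:H - {\<one>}. H - generate G {x}) = (p\<^sup>2 - 1) * (p\<^sup>2 - p)"
  proof -
    have "card (H - generate G {x}) = p\<^sup>2 - p" if x: "x \<in> H - {\<one>}" for x
    proof -
      have "generate G {x} \<subseteq> H"
        using x H(1) by (intro generate_singleton_subset) auto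
      then show ?thesis
        using x HG card_generate[of x] finite_subset[OF _ finH] H(2)
        by (subst card_Diff_subset) auto
    qed
    then show ?thesis
      using finH H subgroup.one_closed[OF H(1)] by (subst card_SigmaI) auto
  qed
  ultimately show "card {z \<in> planar_pairs. (case z of (x, y) \<Rightarrow> generate G {x, y}) = H} = (p\<^sup>2 - 1) * (p\<^sup>2 - p)"
    by simp
qed (rule finite_subgroups[OF fin])

text \<open>In a commutative group the product of <x> and <y> is a subgroup with at most
  \<open>p\<^sup>2\<close> elements, which contains x and y. The order of <x, y> is a power of
  \<open>p\<close> larger than \<open>p\<close>, hence exactly \<open>p\<^sup>2\<close>.\<close>

lemma planar_pairs_comm:
  assumes comm: "\<And>x y. x \<in> carrier G \<Longrightarrow> y \<in> carrier G \<Longrightarrow> x \<otimes> y = y \<otimes> x"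
    and card: "card (carrier G) = p ^ n"
  shows "planar_pairs = independent_pairs"
proof -
  interpret comm_group G
    by (rule group_comm_groupI) (rule comm)
  have "card (generate G {x, y}) = p\<^sup>2" if xy: "(x, y) \<in> independent_pairs" for x y
  proof -
    have xyG: "x \<in> carrier G" "y \<in> carrier G" "x \<noteq> \<one>" and y: "y \<notin> generate G {x}"
      using xy by (auto simp: independent_pairs_def)
    have "y \<noteq> \<one>"
      using y generate.one by metis
    let ?M = "generate G {x} <#> generate G {y}"
    have sub: "subgroup (generate G {x}) G" "subgroup (generate G {y}) G" "subgroup (generate G {x, y}) G"
      using xyG by (auto intro!: generate_is_subgroup)
    have M: "?M = (\<lambda>(u, v). u \<otimes> v) ` (generate G {x} \<times> generate G {y})"
      by (auto simp: set_mult_def)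
    have "x \<otimes> \<one> \<in> ?M" "\<one> \<otimes> y \<in> ?M"
      unfolding set_mult_def using generate.incl[of _ _ G] generate.one[of G] by blast+
    then have "generate G {x, y} \<subseteq> ?M"
      using mult_subgroups[OF sub(1,2)] xyG by (intro generate_subgroup_incl) auto
    moreover have "finite ?M" "card ?M \<le> p * p"
      using card_image_le[of "generate G {x} \<times> generate G {y}" "\<lambda>(u, v). u \<otimes> v"]
        xyG \<open>y \<noteq> \<one>\<close> finite_generate[of "{x}"] finite_generate[of "{y}"]
      unfolding M by (auto simp: card_cartesian_product card_generate)
    ultimately have le: "card (generate G {x, y}) \<le> p\<^sup>2"
      unfolding power2_eq_square by (meson card_mono order_trans)
    have "card (generate G {x, y}) dvd p ^ n"
      using card_subgroup_dvd[OF sub(3)] card by simp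
    then obtain i where i: "card (generate G {x, y}) = p ^ i"
      using prime by (auto simp: divides_primepow_nat)
    have "generate G {x} \<subset> generate G {x, y}"
      using y mono_generate[of "{x}" "{x, y}"] generate.incl[of y "{x, y}" G] by auto
    then have "p ^ 1 < p ^ i"
      using psubset_card_mono[OF finite_generate, of "{x, y}" "generate G {x}"] xyG
      by (simp add: card_generate i(1)[symmetric])
    then have "1 < i"
      using prime_gt_1_nat[OF prime] power_less_imp_less_exp by blast
    moreover have "i \<le> 2"
      using le unfolding i by (rule power_le_imp_le_exp[OF prime_gt_1_nat[OF prime]])
    ultimately show ?thesis
      using i by (metis Suc_1 Suc_leI le_antisym)
  qed
  then show ?thesis
    by (auto simp: planar_pairs_def)
qed

text \<open>
  With \<open>P\<close> the subgroup generated by \<open>x\<close>, the double coset \<open>P y P\<close> does not contain \<open>\<one>\<close>, so it has fewer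
  than \<open>p\<^sup>2\<close> elements; a coincidence \<open>u y v = u' y v'\<close> shows that \<open>y\<close> normalises \<open>P\<close>.
\<close>

lemma normalises_in_order_p2:
  assumes H: "subgroup H G" "card H = p\<^sup>2"
    and x: "x \<in> H" "x \<noteq> \<one>" and y: "y \<in> H" "y \<notin> generate G {x}"
  obtains w where "w \<in> generate G {x}" "x \<otimes> y = y \<otimes> w"
proof -
  let ?P = "generate G {x}"
  have xyG: "x \<in> carrier G" "y \<in> carrier G"
    using x y subgroup.mem_carrier[OF H(1)] by auto
  have P: "subgroup ?P G" "?P \<subseteq> H"
    using xyG x H generate_is_subgroup generate_singleton_subset by auto
  have PG: "u \<in> carrier G" if "u \<in> ?P" for u
    using subgroup.mem_carrier[OF P(1) that] .
  have finH: "finite H"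
    using subgroup.subset[OF H(1)] fin by (rule finite_subset)
  define h where "h = (\<lambda>(u, v). u \<otimes> y \<otimes> v)"
  have "h ` (?P \<times> ?P) \<subseteq> H - {\<one>}"
  proof clarify
    fix u v assume uv: "u \<in> ?P" "v \<in> ?P"
    have "h (u, v) \<in> H"
      using uv P y H by (auto simp: h_def intro!: subgroup.m_closed[OF H(1)])
    moreover have "h (u, v) \<noteq> \<one>"
    proof
      assume "h (u, v) = \<one>"
      then have "inv (y \<otimes> v) = u"
        using uv PG xyG by (intro inv_equality) (auto simp: h_def m_assoc)
      then have "y \<otimes> v = inv u"
        using uv PG xyG by auto
      then have "y = inv u \<otimes> inv v"
        using uv PG xyG by (subst inv_solve_right) auto
      then show False
        using y uv subgroup.m_closed[OF P(1)] subgroup.m_inv_closed[OF P(1)] by auto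
    qed
    ultimately show "h (u, v) \<in> H - {\<one>}"
      by simp
  qed
  then have "card (h ` (?P \<times> ?P)) \<le> p\<^sup>2 - 1"
    using card_mono[of "H - {\<one>}"] finH H(2) subgroup.one_closed[OF H(1)] by simp
  moreover have "card (?P \<times> ?P) = p\<^sup>2"
    using xyG x by (simp add: card_cartesian_product card_generate power2_eq_square)
  moreover have "p\<^sup>2 > 0"
    using prime_gt_0_nat[OF prime] by simp
  ultimately have "\<not> inj_on h (?P \<times> ?P)"
    using card_image[of h "?P \<times> ?P"] by linarith
  then obtain u v u' v' where uv: "u \<in> ?P" "v \<in> ?P" "u' \<in> ?P" "v' \<in> ?P"
    and eq: "u \<otimes> y \<otimes> v = u' \<otimes> y \<otimes> v'" and ne: "(u, v) \<noteq> (u', v')"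
    by (auto simp: inj_on_def h_def)
  have [simp]: "u \<in> carrier G" "v \<in> carrier G" "u' \<in> carrier G" "v' \<in> carrier G" "y \<in> carrier G"
    using uv PG xyG by auto
  \<comment> \<open>Separating the two sides of the coincidence gives
    \<open>s \<otimes> y = y \<otimes> w\<close> with both \<open>s\<close> and \<open>w\<close> in
    P.\<close>
  define s where "s = inv u' \<otimes> u"
  define w where "w = v' \<otimes> inv v"
  have sw: "s \<in> ?P" "w \<in> ?P"
    using uv subgroup.m_closed[OF P(1)] subgroup.m_inv_closed[OF P(1)] by (auto simp: s_def w_def)
  have "u \<otimes> y = u' \<otimes> (y \<otimes> w)"
    using eq by (simp add: w_def inv_solve_right m_assoc[symmetric])
  then have "y \<otimes> w = s \<otimes> y"
    using sw PG by (simp add: s_def m_assoc inv_solve_left)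
  have "s \<noteq> \<one>"
  proof
    assume "s = \<one>"
    moreover have "u' \<otimes> s = u"
      by (simp add: s_def flip: m_assoc)
    ultimately have "u = u'"
      by simp
    then show False
      using ne eq by simp
  qed
  \<comment> \<open>A nontrivial element of a group of prime order generates it, so x is a power of
    \<open>s\<close> and the relation between \<open>s\<close> and \<open>w\<close> passes to this
    power.\<close>
  then have "x \<in> generate G {s}"
    using generate_eq[OF xyG(1) sw(1)] by (auto intro: generate.incl)
  then obtain k :: int where "x = s [^] k"
    using generate_pow[of s] sw PG by auto
  then have "x \<otimes> y = y \<otimes> w [^] k"
    using intertwine_int_pow[of y w s k] \<open>y \<otimes> w = s \<otimes> y\<close> sw PG by simp
  moreover have "w [^] k \<in> ?P"
    by (rule subgroup_int_pow_closed[OF P(1) sw(2)])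
  ultimately show ?thesis
    using that by blast
qed

text \<open>Within <x, y> each of x and y normalises the subgroup generated by the other, so their
  commutator z lies in both <x> and <y>. These have prime order and differ, hence meet
  trivially.\<close>

lemma planar_pairs_commute:
  assumes "(x, y) \<in> planar_pairs"
  shows "x \<otimes> y = y \<otimes> x"
proof -
  let ?H = "generate G {x, y}"
  have [simp]: "x \<in> carrier G" "y \<in> carrier G" and x: "x \<noteq> \<one>" and y: "y \<notin> generate G {x}"
    and card: "card ?H = p\<^sup>2"
    using assms by (auto simp: planar_pairs_def independent_pairs_def)
  have H: "subgroup ?H G" "x \<in> ?H" "y \<in> ?H"
    by (auto intro: generate_is_subgroup generate.incl)
  have y1: "y \<noteq> \<one>"
    using y generate.one by metis
  have y_gen: "y \<in> generate G {y}"
    by (auto intro: generate.incl)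
  have x_gen: "x \<in> generate G {x}"
    by (auto intro: generate.incl)
  have xy: "x \<notin> generate G {y}"
    using generate_eq[of y x] x y y_gen by auto
  obtain w where w: "w \<in> generate G {x}" "x \<otimes> y = y \<otimes> w"
    using normalises_in_order_p2[OF H(1) card H(2) x H(3) y] .
  obtain w' where w': "w' \<in> generate G {y}" "y \<otimes> x = x \<otimes> w'"
    using normalises_in_order_p2[OF H(1) card H(3) y1 H(2) xy] .
  have sub: "subgroup (generate G {x}) G" "subgroup (generate G {y}) G"
    by (auto intro!: generate_is_subgroup)
  have [simp]: "w \<in> carrier G" "w' \<in> carrier G"
    using w w' sub by (auto dest: subgroup.mem_carrier)
  define z where "z = inv x \<otimes> w"
  have "x \<otimes> y = y \<otimes> x \<otimes> z"
    using w by (simp add: z_def m_assoc[symmetric]) (simp add: m_assoc)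
  then have "x \<otimes> y = x \<otimes> (w' \<otimes> z)"
    using w' by (simp add: z_def m_assoc)
  then have "y = w' \<otimes> z"
    by (simp add: z_def)
  then have "z = inv w' \<otimes> y"
    by (simp add: z_def inv_solve_left)
  then have "z \<in> generate G {y}"
    using w' y_gen subgroup.m_closed[OF sub(2)] subgroup.m_inv_closed[OF sub(2)] by auto
  moreover have "z \<in> generate G {x}"
    using w x_gen subgroup.m_closed[OF sub(1)] subgroup.m_inv_closed[OF sub(1)] by (auto simp: z_def)
  ultimately have "z = \<one>"
    using generate_eq[of x z] generate_eq[of y z] y y_gen by auto
  then show ?thesis
    using \<open>x \<otimes> y = y \<otimes> x \<otimes> z\<close> by simp
qed

lemma comm_if_planar_pairs:
  assumes "planar_pairs = independent_pairs" "x \<in> carrier G" "y \<in> carrier G"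
  shows "x \<otimes> y = y \<otimes> x"
proof -
  consider "x = \<one>" | "y \<in> generate G {x}" | "(x, y) \<in> independent_pairs"
    using assms by (auto simp: independent_pairs_def)
  then show ?thesis
  proof cases
    case 2
    then obtain k :: int where "y = x [^] k"
      using generate_pow[OF assms(2)] by auto
    then show ?thesis
      using intertwine_int_pow[of x x x k] assms(2) by simp
  qed (use assms planar_pairs_commute in auto)
qed

end

subsection \<open>Recognising abelian groups\<close>

lemma pow_product_group:
  assumes "\<And>i. i \<in> I \<Longrightarrow> group (G i)" "x \<in> carrier (product_group I G)"
  shows "x [^]\<^bsub>product_group I G\<^esub> (k::nat) = (\<lambda>i\<in>I. x i [^]\<^bsub>G i\<^esub> k)"
proof (induction k)
  case 0
  then show ?case
    by (auto simp: nat_pow_def)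
next
  case (Suc k)
  then show ?case
    by (auto simp: fun_eq_iff)
qed

lemma group_abelian_p_group: "group (abelian_p_group p n lam)"
  by (simp add: abelian_p_group_def)

lemma comm_abelian_p_group:
  "x \<otimes>\<^bsub>abelian_p_group p n lam\<^esub> y = y \<otimes>\<^bsub>abelian_p_group p n lam\<^esub> x"
  by (simp add: abelian_p_group_def add.commute)

lemma carrier_abelian_p_group:
  "p > 0 \<Longrightarrow> carrier (abelian_p_group p n lam) = (\<Pi>\<^sub>E i\<in>{1..n}. {0..<int (p ^ lam i)})"
  by (simp add: abelian_p_group_def carrier_integer_mod_group)

lemma finite_abelian_p_group: "p > 0 \<Longrightarrow> finite (carrier (abelian_p_group p n lam))"
  by (auto simp: carrier_abelian_p_group intro: finite_PiE)

lemma card_abelian_p_group: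
  "p > 0 \<Longrightarrow> card (carrier (abelian_p_group p n lam)) = (\<Prod>i=1..n. p ^ lam i)"
  by (simp add: carrier_abelian_p_group card_PiE nat_power_eq)

lemma pow_abelian_p_group:
  assumes "x \<in> carrier (abelian_p_group p n lam)"
  shows "x [^]\<^bsub>abelian_p_group p n lam\<^esub> (k::nat) = (\<lambda>i\<in>{1..n}. int k * x i mod int (p ^ lam i))"
  using assms unfolding abelian_p_group_def by (subst pow_product_group) auto

lemma (in comm_group) ordered_power_prod_add:
  assumes "\<And>i. i \<in> {1..k} \<Longrightarrow> a i \<in> carrier G"
  shows "ordered_power_prod G a (\<lambda>i. x i + y i) k =
    ordered_power_prod G a x k \<otimes> ordered_power_prod G a y k"
  using assms
proof (induction k)
  case (Suc k)
  have "a (Suc k) \<in> carrier G" "a \<in> {1..k} \<rightarrow> carrier G"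
    using Suc.prems by auto
  then show ?case
    using Suc by (simp add: int_pow_mult m_ac)
qed auto

lemma (in comm_group) ordered_power_prod_scale:
  assumes "\<And>i. i \<in> {1..k} \<Longrightarrow> a i \<in> carrier G"
  shows "ordered_power_prod G a (\<lambda>i. r * x i) k = ordered_power_prod G a x k [^] r"
  using assms
proof (induction k)
  case (Suc k)
  have "a (Suc k) \<in> carrier G" "a \<in> {1..k} \<rightarrow> carrier G"
    using Suc.prems by auto
  then show ?case
    using Suc by (simp add: int_pow_distrib int_pow_pow mult.commute)
qed auto

text \<open>The isomorphism is built from the model towards G, where it sends a vector to the
  product of powers it prescribes; it respects addition because exponents may be reduced modulo the
  orders. Injectivity and equal cardinalities make it bijective.\<close>

lemma (in comm_group) iso_abelian_p_groupI:
  assumes p: "p > 0" and fin: "finite (carrier G)"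
    and card: "card (carrier G) = (\<Prod>i=1..n. p ^ lam i)"
    and a: "\<And>i. i \<in> {1..n} \<Longrightarrow> a i \<in> carrier G"
    and pow: "\<And>i. i \<in> {1..n} \<Longrightarrow> a i [^] int (p ^ lam i) = \<one>"
    and inj: "inj_on (\<lambda>x. ordered_power_prod G a x n) (\<Pi>\<^sub>E i\<in>{1..n}. {0..<int (p ^ lam i)})"
  shows "G \<cong> abelian_p_group p n lam"
proof -
  let ?A = "abelian_p_group p n lam"
  let ?f = "\<lambda>x. ordered_power_prod G a x n"
  have closed: "?f x \<in> carrier G" for x
    using a by (intro ordered_power_prod_closed) auto
  have "?f \<in> hom ?A G"
  proof (rule homI)
    fix x y assume "x \<in> carrier ?A" "y \<in> carrier ?A"
    have "x \<otimes>\<^bsub>?A\<^esub> y = (\<lambda>i\<in>{1..n}. (x i + y i) mod int (p ^ lam i))"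
      by (simp add: abelian_p_group_def)
    then show "?f (x \<otimes>\<^bsub>?A\<^esub> y) = ?f x \<otimes> ?f y"
      using ordered_power_prod_mod[OF a pow, where x = "\<lambda>i. x i + y i"]
        ordered_power_prod_add[OF a, where x = x and y = y]
      by simp
  qed (rule closed)
  moreover have "?f ` carrier ?A = carrier G"
  proof (rule card_subset_eq[OF fin])
    show "?f ` carrier ?A \<subseteq> carrier G"
      using closed by auto
    show "card (?f ` carrier ?A) = card (carrier G)"
      using inj card_abelian_p_group[OF p, of n lam] unfolding carrier_abelian_p_group[OF p]
      by (simp only: card_image card)
  qed
  ultimately have "?f \<in> iso ?A G"
    using inj p by (simp add: iso_def bij_betw_def carrier_abelian_p_group)
  then have "?A \<cong> G"
    by (auto simp: is_iso_def)
  then show ?thesis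
    by (rule group.iso_sym[OF group_abelian_p_group])
qed

text \<open>This is extension of a linearly independent family over the field with \<open>p\<close>
  elements, written multiplicatively. The span of k generators has at most \<open>p ^ k\<close>
  elements, which is less than the order of G, so a new generator can be chosen outside it.\<close>

lemma (in comm_group) exists_independent_generators:
  assumes p: "prime p" and exponent: "\<And>x. x \<in> carrier G \<Longrightarrow> x [^] int p = \<one>"
    and card: "card (carrier G) = p ^ n" and "k \<le> n"
  shows "\<exists>a. (\<forall>i\<in>{1..k}. a i \<in> carrier G) \<and>
    inj_on (\<lambda>x. ordered_power_prod G a x k) (\<Pi>\<^sub>E i\<in>{1..k}. {0..<int p})"
  using \<open>k \<le> n\<close>
proof (induction k)
  case 0
  show ?case
    by simp
next
  case (Suc k)
  let ?B = "\<lambda>k. \<Pi>\<^sub>E i\<in>{1..k}. {0..<int p}"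
  obtain a where a: "\<And>i. i \<in> {1..k} \<Longrightarrow> a i \<in> carrier G"
    and inj: "inj_on (\<lambda>x. ordered_power_prod G a x k) (?B k)"
    using Suc.IH[OF Suc_leD[OF Suc.prems]] by blast
  let ?K = "range (\<lambda>x. ordered_power_prod G a x k)"
  have "card ?K \<le> p ^ k" "finite ?K"
    using card_ordered_power_prods_le[of k a "\<lambda>_. p"] a exponent prime_gt_0_nat[OF p] by auto
  moreover have "p ^ k < p ^ n"
    using Suc.prems prime_gt_1_nat[OF p] by simp
  ultimately obtain g where g: "g \<in> carrier G" "g \<notin> ?K"
    using card by (metis card_mono leD le_trans subsetI)
  define b where "b = a(Suc k := g)"
  have b: "b i \<in> carrier G" if "i \<in> {1..Suc k}" for i
    using that a g by (cases "i = Suc k") (auto simp: b_def)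
  have prod_b: "ordered_power_prod G b x (Suc k) = ordered_power_prod G a x k \<otimes> g [^] x (Suc k)" for x
    using ordered_power_prod_cong[of k b a x x G] by (simp add: b_def)
  have closed: "ordered_power_prod G a x k \<in> carrier G" for x
    using a by (intro ordered_power_prod_closed) auto
  have "inj_on (\<lambda>x. ordered_power_prod G b x (Suc k)) (?B (Suc k))"
  proof (rule inj_onI)
    fix x y assume x: "x \<in> ?B (Suc k)" and y: "y \<in> ?B (Suc k)"
      and eq: "ordered_power_prod G b x (Suc k) = ordered_power_prod G b y (Suc k)"
    let ?d = "x (Suc k) - y (Suc k)"
    \<comment> \<open>A collision puts a power of \<open>g\<close> into the span of the old
      generators. The exponent difference is written with the factor -1 so that additivity and
      scaling apply.\<close>
    have d: "g [^] ?d = ordered_power_prod G a (\<lambda>i. y i + (-1) * x i) k"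
    proof -
      have "ordered_power_prod G a x k \<otimes> g [^] x (Suc k) = ordered_power_prod G a y k \<otimes> g [^] y (Suc k)"
        using eq by (simp only: prod_b)
      then have "g [^] x (Suc k) = inv (ordered_power_prod G a x k) \<otimes> (ordered_power_prod G a y k \<otimes> g [^] y (Suc k))"
        using g(1) closed by (subst inv_solve_left) auto
      then have "g [^] x (Suc k) \<otimes> inv (g [^] y (Suc k)) =
          ordered_power_prod G a y k \<otimes> inv (ordered_power_prod G a x k)"
        using g(1) closed by (simp add: m_assoc) (simp add: m_comm)
      moreover have "ordered_power_prod G a (\<lambda>i. y i + r * x i) k =
          ordered_power_prod G a y k \<otimes> ordered_power_prod G a x k [^] r" for r
        using ordered_power_prod_add[OF a, where x = y and y = "\<lambda>i. r * x i"]
          ordered_power_prod_scale[OF a, where r = r and x = x] by simp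
      ultimately show ?thesis
        using g(1) closed by (simp only: int_pow_diff int_pow_neg int_pow_1)
    qed
    have xy: "x (Suc k) = y (Suc k)"
    proof (rule ccontr)
      assume "x (Suc k) \<noteq> y (Suc k)"
      moreover have "x (Suc k) \<in> {0..<int p}" "y (Suc k) \<in> {0..<int p}"
        using x y by (auto simp: PiE_iff)
      ultimately have "\<not> int p dvd ?d"
        using zdvd_not_zless[of ?d "int p"] zdvd_not_zless[of "- ?d" "int p"]
        by (auto simp: linorder_neq_iff dvd_diff_commute)
      then have "coprime ?d (int p)"
        using p by (metis coprime_commute prime_imp_coprime prime_nat_int_transfer)
      \<comment> \<open>Raising to an inverse of the exponent modulo \<open>p\<close> recovers
        \<open>g\<close> itself, which would then lie in the span.\<close>
      then obtain r where "[?d * r = 1] (mod int p)"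
        using cong_solve_coprime_int by blast
      then obtain s where "1 = ?d * r + int p * s"
        by (auto simp: cong_iff_lin)
      then have "?d * r = 1 + int p * (- s)"
        by simp
      then have "g [^] (?d * r) = g"
        using g exponent by (simp add: int_pow_mult flip: int_pow_pow del: mult_minus_right)
      moreover have "g [^] (?d * r) = ordered_power_prod G a (\<lambda>i. r * (y i + (-1) * x i)) k"
      proof -
        have "ordered_power_prod G a (\<lambda>i. r * (y i + (-1) * x i)) k = (g [^] ?d) [^] r"
          unfolding d by (rule ordered_power_prod_scale[OF a])
        then show ?thesis
          using g(1) by (simp only: int_pow_pow)
      qed
      ultimately show False
        using g by auto
    qed
    have restrict_eq: "ordered_power_prod G a (restrict z {1..k}) k = ordered_power_prod G a z k" for z
      by (rule ordered_power_prod_cong) auto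
    have "ordered_power_prod G a x k = ordered_power_prod G a y k"
      using eq g(1) closed unfolding prod_b xy by simp
    then have "restrict x {1..k} = restrict y {1..k}"
      using x y by (intro inj_onD[OF inj]) (simp_all only: restrict_eq, auto simp: PiE_iff)
    then have "x i = y i" if "i \<in> {1..k}" for i
      using that by (metis restrict_apply')
    then have "x i = y i" if "i \<in> {1..Suc k}" for i
      using that xy by (cases "i = Suc k") auto
    then show "x = y"
      using x y by (intro PiE_ext) auto
  qed
  then show ?case
    using b by blast
qed

lemma (in comm_group) elementary_abelian_iso:
  assumes p: "prime p" and exponent: "\<And>x. x \<in> carrier G \<Longrightarrow> x [^] int p = \<one>"
    and fin: "finite (carrier G)" and card: "card (carrier G) = p ^ n"
    and lam: "\<And>i. i \<in> {1..n} \<Longrightarrow> lam i = 1"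
  shows "G \<cong> abelian_p_group p n lam"
proof -
  obtain a where a: "\<And>i. i \<in> {1..n} \<Longrightarrow> a i \<in> carrier G"
    and inj: "inj_on (\<lambda>x. ordered_power_prod G a x n) (\<Pi>\<^sub>E i\<in>{1..n}. {0..<int p})"
    using exists_independent_generators[OF p exponent card order_refl] by blast
  have box: "(\<Pi>\<^sub>E i\<in>{1..n}. {0..<int (p ^ lam i)}) = (\<Pi>\<^sub>E i\<in>{1..n}. {0..<int p})"
    using lam by (intro PiE_cong) simp
  show ?thesis
  proof (rule iso_abelian_p_groupI[where a = a])
    show "inj_on (\<lambda>x. ordered_power_prod G a x n) (\<Pi>\<^sub>E i\<in>{1..n}. {0..<int (p ^ lam i)})"
      using inj by (simp only: box)
  qed (use a lam exponent fin card prime_gt_0_nat[OF p] in auto)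
qed

lemma (in group) cyclic_iso_abelian_p_group:
  assumes p: "prime p" and fin: "finite (carrier G)" and card: "card (carrier G) = p ^ lam 1"
    and g: "g \<in> carrier G" "ord g = p ^ lam 1"
  shows "G \<cong> abelian_p_group p 1 lam"
proof -
  have gen: "generate G {g} = carrier G"
    using g fin card generate_incl[of "{g}"] by (intro card_subset_eq) (auto simp: generate_pow_card)
  have comm: "x \<otimes> y = y \<otimes> x" if xy: "x \<in> carrier G" "y \<in> carrier G" for x y
  proof -
    obtain i j :: int where "x = g [^] i" "y = g [^] j"
      using xy generate_pow[OF g(1)] unfolding gen by blast
    then show ?thesis
      using g by (simp add: add.commute flip: int_pow_mult)
  qed
  interpret comm_group G
    by (rule group_comm_groupI) (rule comm)
  show ?thesis
  proof (rule iso_abelian_p_groupI[where a = "\<lambda>_. g"])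
    show "inj_on (\<lambda>x. ordered_power_prod G (\<lambda>_. g) x 1) (\<Pi>\<^sub>E i\<in>{1..1}. {0..<int (p ^ lam i)})"
    proof (rule inj_onI)
      fix x y :: "nat \<Rightarrow> int"
      assume x: "x \<in> (\<Pi>\<^sub>E i\<in>{1..1}. {0..<int (p ^ lam i)})" and y: "y \<in> (\<Pi>\<^sub>E i\<in>{1..1}. {0..<int (p ^ lam i)})"
        and "ordered_power_prod G (\<lambda>_. g) x 1 = ordered_power_prod G (\<lambda>_. g) y 1"
      then have "g [^] x 1 = g [^] y 1"
        using g by simp
      then have "int (p ^ lam 1) dvd y 1 - x 1"
        using g by (simp add: int_pow_eq)
      then have "y 1 mod int (p ^ lam 1) = x 1 mod int (p ^ lam 1)"
        by (simp only: mod_eq_dvd_iff)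
      moreover have "x 1 \<in> {0..<int (p ^ lam 1)}" "y 1 \<in> {0..<int (p ^ lam 1)}"
        using x y by (auto simp: PiE_iff)
      ultimately have "x 1 = y 1"
        by simp
      then show "x = y"
        using x y by (intro PiE_ext) auto
    qed
    show "g [^] int (p ^ lam i) = \<one>" if "i \<in> {1..1}" for i
      using that g by (simp only: int_pow_int) (simp add: pow_eq_id)
  qed (use fin card g prime_gt_0_nat[OF p] in auto)
qed

section \<open>The groups that their zeta function determines\<close>

lemma abelian_p_group_cyclic:
  assumes p: "prime p" and lam: "lam 1 > 0"
  shows "\<exists>g\<in>carrier (abelian_p_group p 1 lam). group.ord (abelian_p_group p 1 lam) g = p ^ lam 1"
proof -
  let ?A = "abelian_p_group p 1 lam"
  interpret A: group ?A
    by (rule group_abelian_p_group)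
  define g :: "nat \<Rightarrow> int" where "g = (\<lambda>i\<in>{1..1}. 1)"
  have "1 < p ^ lam 1"
    using prime_gt_1_nat[OF p] lam by (rule one_less_power)
  then have g: "g \<in> carrier ?A"
    using prime_gt_0_nat[OF p] by (auto simp: carrier_abelian_p_group g_def simp flip: of_nat_power)
  have "g [^]\<^bsub>?A\<^esub> k = \<one>\<^bsub>?A\<^esub> \<longleftrightarrow> p ^ lam 1 dvd k" for k :: nat
  proof -
    have "g [^]\<^bsub>?A\<^esub> k = \<one>\<^bsub>?A\<^esub> \<longleftrightarrow> int k mod int (p ^ lam 1) = 0"
      unfolding pow_abelian_p_group[OF g] by (auto simp: abelian_p_group_def g_def fun_eq_iff)
    also have "\<dots> \<longleftrightarrow> p ^ lam 1 dvd k"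
      by (simp only: mod_eq_0_iff_dvd int_dvd_int_iff)
    finally show ?thesis .
  qed
  then have "A.ord g = p ^ lam 1"
    using A.ord_unique[OF g] by blast
  then show ?thesis
    using g by blast
qed

text \<open>A cyclic group has at most one subgroup of each order; equal counts pass this to G,
  where it forces an element whose order is that of G.\<close>

lemma cyclic_determined_by_zeta:
  assumes p: "prime p" and lam: "lam 1 > 0" and G: "group G" "finite (carrier G)"
    and zeta: "group_zeta G = group_zeta (abelian_p_group p 1 lam)"
  shows "G \<cong> abelian_p_group p 1 lam"
proof -
  let ?A = "abelian_p_group p 1 lam"
  interpret G: group G by fact
  interpret A: group ?A
    by (rule group_abelian_p_group)
  have finA: "finite (carrier ?A)"
    using finite_abelian_p_group prime_gt_0_nat[OF p] .
  have cardA: "card (carrier ?A) = p ^ lam 1"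
    using card_abelian_p_group[of p 1 lam] prime_gt_0_nat[OF p] by simp
  then have cardG: "card (carrier G) = p ^ lam 1"
    using group_zeta_eq_imp_card_eq[OF G(1) A.is_group G(2) finA zeta] by simp
  obtain a where a: "a \<in> carrier ?A" "A.ord a = card (carrier ?A)"
    using abelian_p_group_cyclic[where lam = lam, OF p lam] cardA by auto
  have "subgroup_count G (p ^ k) \<le> 1" for k
    using group_zeta_eq_imp_subgroup_count_eq[OF G(2) finA zeta, of "p ^ k"]
      A.subgroup_count_le_1_if_cyclic[OF finA a] prime_gt_0_nat[OF p] by simp
  then obtain g where "g \<in> carrier G" "G.ord g = p ^ lam 1"
    using G.cyclic_if_unique_subgroups[OF p G(2) cardG] by blast
  then show ?thesis
    by (rule G.cyclic_iso_abelian_p_group[where lam = lam, OF p G(2) cardG])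
qed

lemma (in group) pow_prime_iff_ord:
  assumes "prime p"
  shows "(\<forall>x\<in>carrier G. x [^] p = \<one>) \<longleftrightarrow> (\<forall>x\<in>carrier G - {\<one>}. ord x = p)"
proof -
  have "x [^] p = \<one> \<longleftrightarrow> x = \<one> \<or> ord x = p" if x: "x \<in> carrier G" for x
    unfolding pow_eq_id[OF x] using assms ord_eq_1[OF x] by (auto simp: prime_nat_iff)
  then show ?thesis
    by blast
qed

lemma elementary_abelian_determined_by_zeta:
  assumes p: "prime p" and lam: "\<And>i. i \<in> {1..n} \<Longrightarrow> lam i = 1"
    and G: "group G" "finite (carrier G)"
    and zeta: "group_zeta G = group_zeta (abelian_p_group p n lam)"
  shows "G \<cong> abelian_p_group p n lam"
proof -
  let ?A = "abelian_p_group p n lam"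
  interpret G: group G by fact
  interpret A: group ?A
    by (rule group_abelian_p_group)
  have p0: "p > 0"
    using prime_gt_0_nat[OF p] .
  have finA: "finite (carrier ?A)"
    using finite_abelian_p_group p0 .
  have cardA: "card (carrier ?A) = p ^ n"
    using card_abelian_p_group[of p n lam] p0 lam by simp
  then have cardG: "card (carrier G) = p ^ n"
    using group_zeta_eq_imp_card_eq[OF G(1) A.is_group G(2) finA zeta] by simp
  have count: "subgroup_count G m = subgroup_count ?A m" if "m \<ge> 1" for m
    using group_zeta_eq_imp_subgroup_count_eq[OF G(2) finA zeta that] .
  have "x [^]\<^bsub>?A\<^esub> p = \<one>\<^bsub>?A\<^esub>" if "x \<in> carrier ?A" for x
    unfolding pow_abelian_p_group[OF that] using lam by (auto simp: abelian_p_group_def)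
  then have ordA: "A.ord x = p" if "x \<in> carrier ?A" "x \<noteq> \<one>\<^bsub>?A\<^esub>" for x
    using A.pow_prime_iff_ord[OF p] that by blast
  have "{x \<in> carrier ?A. A.ord x = p} = carrier ?A - {\<one>\<^bsub>?A\<^esub>}"
    using ordA p A.ord_id by auto
  then have "card {x \<in> carrier ?A. A.ord x = p} = p ^ n - 1"
    using finA cardA by simp
  \<comment> \<open>Both sides are \<open>p - 1\<close> times the common number of subgroups of
    order \<open>p\<close>.\<close>
  moreover have "card {x \<in> carrier G. G.ord x = p} = card {x \<in> carrier ?A. A.ord x = p}"
    using count[of p] p0 unfolding G.card_elements_of_prime_order[OF p G(2)] A.card_elements_of_prime_order[OF p finA]
    by simp
  ultimately have "card {x \<in> carrier G. G.ord x = p} = card (carrier G - {\<one>\<^bsub>G\<^esub>})"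
    using G(2) cardG by simp
  moreover have "{x \<in> carrier G. G.ord x = p} \<subseteq> carrier G - {\<one>\<^bsub>G\<^esub>}"
    using p G.ord_id by auto
  ultimately have "{x \<in> carrier G. G.ord x = p} = carrier G - {\<one>\<^bsub>G\<^esub>}"
    using G(2) by (intro card_subset_eq) auto
  then have ordG: "G.ord x = p" if "x \<in> carrier G" "x \<noteq> \<one>\<^bsub>G\<^esub>" for x
    using that by blast
  interpret G: finite_exponent_group G p
    by unfold_locales (use p G ordG in auto)
  interpret A: finite_exponent_group ?A p
    by unfold_locales (use p finA ordA in auto)
  have "A.planar_pairs = A.independent_pairs"
    by (rule A.planar_pairs_comm[OF comm_abelian_p_group cardA])
  \<comment> \<open>Independent pairs are counted by the order alone and planar pairs by the number
    of subgroups of order \<open>p\<^sup>2\<close>; G shares both with the model, where the two sets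
    coincide.\<close>
  then have "card G.planar_pairs = card G.independent_pairs"
    using count[of "p\<^sup>2"] p0 G.card_planar_pairs A.card_planar_pairs
      G.card_independent_pairs A.card_independent_pairs cardA cardG by simp
  then have "G.planar_pairs = G.independent_pairs"
    by (intro card_subset_eq[OF G.finite_independent_pairs]) (auto simp: G.planar_pairs_def)
  then interpret G: comm_group G
    by (intro G.group_comm_groupI G.comm_if_planar_pairs)
  have "x [^]\<^bsub>G\<^esub> int p = \<one>\<^bsub>G\<^esub>" if "x \<in> carrier G" for x
    using G.pow_prime_iff_ord[OF p] ordG that unfolding int_pow_int by blast
  then show ?thesis
    by (rule G.elementary_abelian_iso[OF p _ G(2) cardG lam])
qed

theorem proposition3p1:
  fixes p :: nat and G :: "('a, 'b) monoid_scheme"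
  assumes "prime p"
  shows
    "(\<forall>n lam. n \<ge> 1 \<and> lam \<in> Lambda_plus n \<and> (n = 1 \<or> lam 1 = 1) \<and>
        group G \<and> finite (carrier G) \<and> group_zeta G = group_zeta (abelian_p_group p n lam)
        \<longrightarrow> G \<cong> abelian_p_group p n lam) \<and>
     (\<forall>n lam. n \<ge> 2 \<and> lam \<in> Lambda_plus n \<and> lam 1 > lam 2 \<and> (p = 2 \<longrightarrow> lam 1 \<ge> 3) \<longrightarrow>
        (\<exists>H :: nat word set monoid.
           group H \<and> finite (carrier H) \<and> \<not> comm_group H \<and>
           group_zeta H = group_zeta (abelian_p_group p n lam)) \<and>
        group (twisted_p_group p n lam) \<and> finite (carrier (twisted_p_group p n lam)) \<and>
        \<not> comm_group (twisted_p_group p n lam) \<and>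
        group_zeta (twisted_p_group p n lam) = group_zeta (abelian_p_group p n lam))"
proof (intro conjI allI impI; elim conjE)
  fix n and lam :: "nat \<Rightarrow> nat"
  assume n: "n \<ge> 1" and lam: "lam \<in> Lambda_plus n" and cases: "n = 1 \<or> lam 1 = 1"
    and G: "group G" "finite (carrier G)" and zeta: "group_zeta G = group_zeta (abelian_p_group p n lam)"
  have pos: "lam i > 0" if "i \<in> {1..n}" for i
    using lam that by (auto simp: Lambda_plus_def PiE_iff)
  have "lam i \<le> lam 1" if "i \<in> {1..n}" for i
    using lam that n by (auto simp: Lambda_plus_def)
  then have "lam i = 1" if "lam 1 = 1" "i \<in> {1..n}" for i
    using that pos[of i] by (metis One_nat_def Suc_leI le_antisym)
  then show "G \<cong> abelian_p_group p n lam"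
    using cases cyclic_determined_by_zeta[OF assms _ G] elementary_abelian_determined_by_zeta[OF assms _ G zeta]
      pos[of 1] n zeta by auto
next
  fix n and lam :: "nat \<Rightarrow> nat"
  assume "n \<ge> 2" "lam \<in> Lambda_plus n" "lam 1 > lam 2" "p = 2 \<longrightarrow> lam 1 \<ge> 3"
  then interpret twisted_setting p n lam
    using assms by unfold_locales auto
  show "group (twisted_p_group p n lam)" "finite (carrier (twisted_p_group p n lam))"
    "\<not> comm_group (twisted_p_group p n lam)"
    "group_zeta (twisted_p_group p n lam) = group_zeta (abelian_p_group p n lam)"
    by (fact group_twisted_p_group finite_twisted_p_group not_comm_twisted_p_group group_zeta_twisted_p_group)+
  then show "\<exists>H :: nat word set monoid. group H \<and> finite (carrier H) \<and> \<not> comm_group H \<and>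
      group_zeta H = group_zeta (abelian_p_group p n lam)"
    by blast
qed

end
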